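(* The unital $\ell$-group $(M,1)$ corresponding via $\Gamma$ to the free MV-algebra on countably infinitely many free generators, i.e., $\Gamma(M,1)=\mathcal M([0,1]^\omega)$, is not hopfian.
   Context: A unital $\ell$-group $(G,u)$ is an abelian group $G$ with a translation-invariant lattice order and a distinguished unit $u\geq 0$ such that every $0\le x\in G$ is dominated by some integer multiple of $u$. Homomorphisms preserve the group structure, the lattice structure and the unit. An MV-algebra is an abelian monoid $(A,0,\oplus)$ with a unary operation $\neg$ satisfying $\neg\neg x=x$, $x\oplus\neg 0=\neg 0$ and $\neg(\neg x\oplus y)\oplus y=\neg(\neg y\oplus x)\oplus x$. $\Gamma(G,u)$ is the MV-algebra $([0,u],0,\neg,\oplus)$ with $\neg x=u-x$, $x\oplus y=\min(u,x+y)$; $\Gamma$ (with restriction of homomorphisms) is a categorical equivalence between unital $\ell$-groups and MV-algebras, so each MV-algebra is $\Gamma(G,u)$ for a $(G,u)$ unique up to isomorphism. A McNaughton function on $[0,1]^m$ is a continuous $f\colon[0,1]^m\to[0,1]$ for which there are affine linear polynomials $p_1,\dots,p_t$ with integer coefficients such that for each $x$ there is $j$ with $f(x)=p_j(x)$. $\mathcal M([0,1]^\omega)$ is the MV-algebra, with pointwise operations $\neg x=1-x$, $x\oplus y=\min(1,x+y)$, of all functions $g\colon[0,1]^\omega\to[0,1]$ of the form $g(x)=f(x_{i_1},\dots,x_{i_m})$ for some McNaughton function $f$ on $[0,1]^m$ and indices $i_1<\dots<i_m$; it is the free MV-algebra on the countable set of coordinate functions. $(G,u)$ is hopfian if every homomorphism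 of $(G,u)$ onto $(G,u)$ is an automorphism. *)

theory Defs
  imports "HOL-Algebra.Group" "HOL-Algebra.Lattice" "HOL-Analysis.Analysis"
begin

text \<open>
  The abelian group of a unital \<open>\<ell>\<close>-group is rendered by the library's locale \<^locale>\<open>comm_group\<close>,
  whose notation is multiplicative: the group operation \<open>x + y\<close> is \<open>x \<otimes> y\<close>, the neutral
  element \<open>0\<close> is \<open>\<one>\<close>, the inverse \<open>-x\<close> is \<open>inv x\<close>, and the integer multiple \<open>n x\<close> is \<open>x [^] n\<close>.
\<close>

record 'a ulgroup = "'a monoid" +
  lg_le :: "'a \<Rightarrow> 'a \<Rightarrow> bool"
  lg_unit :: 'a

definition lg_order :: "('a, 'b) ulgroup_scheme \<Rightarrow> 'a gorder" where
  "lg_order G = \<lparr>carrier = carrier G, eq = (=), le = lg_le G\<rparr>"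

abbreviation lg_join :: "('a, 'b) ulgroup_scheme \<Rightarrow> 'a \<Rightarrow> 'a \<Rightarrow> 'a" where
  "lg_join G \<equiv> join (lg_order G)"

abbreviation lg_meet :: "('a, 'b) ulgroup_scheme \<Rightarrow> 'a \<Rightarrow> 'a \<Rightarrow> 'a" where
  "lg_meet G \<equiv> meet (lg_order G)"

locale unital_l_group = comm_group G for G (structure) +
  assumes lattice_order: "lattice (lg_order G)"
    and translation_invariant:
      "\<lbrakk>x \<in> carrier G; y \<in> carrier G; z \<in> carrier G; lg_le G x y\<rbrakk> \<Longrightarrow> lg_le G (x \<otimes> z) (y \<otimes> z)"
    and unit_closed: "lg_unit G \<in> carrier G"
    and unit_nonneg: "lg_le G \<one> (lg_unit G)"
    and unit_dominates:
      "\<lbrakk>x \<in> carrier G; lg_le G \<one> x\<rbrakk> \<Longrightarrow> \<exists>n::int. lg_le G x (lg_unit G [^] n)"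

definition ulg_hom :: "('a, 'c) ulgroup_scheme \<Rightarrow> ('b, 'd) ulgroup_scheme \<Rightarrow> ('a \<Rightarrow> 'b) set" where
  "ulg_hom G H = {h \<in> hom G H.
     (\<forall>x\<in>carrier G. \<forall>y\<in>carrier G. h (lg_join G x y) = lg_join H (h x) (h y)) \<and>
     (\<forall>x\<in>carrier G. \<forall>y\<in>carrier G. h (lg_meet G x y) = lg_meet H (h x) (h y)) \<and>
     h (lg_unit G) = lg_unit H}"

text \<open>The inverse of a bijective homomorphism is again a homomorphism, so bijectivity suffices.\<close>

definition ulg_aut :: "('a, 'c) ulgroup_scheme \<Rightarrow> ('a \<Rightarrow> 'a) set" where
  "ulg_aut G = {h \<in> ulg_hom G G. bij_betw h (carrier G) (carrier G)}"

definition hopfian :: "('a, 'c) ulgroup_scheme \<Rightarrow> bool" where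
  "hopfian G \<longleftrightarrow> (\<forall>h\<in>ulg_hom G G. h ` carrier G = carrier G \<longrightarrow> h \<in> ulg_aut G)"

record 'a mv = "'a partial_object" +
  mv_zero :: 'a
  mv_plus :: "'a \<Rightarrow> 'a \<Rightarrow> 'a"
  mv_neg :: "'a \<Rightarrow> 'a"

definition mv_hom :: "('a, 'c) mv_scheme \<Rightarrow> ('b, 'd) mv_scheme \<Rightarrow> ('a \<Rightarrow> 'b) set" where
  "mv_hom A B = {h \<in> carrier A \<rightarrow> carrier B.
     h (mv_zero A) = mv_zero B \<and>
     (\<forall>x\<in>carrier A. \<forall>y\<in>carrier A. h (mv_plus A x y) = mv_plus B (h x) (h y)) \<and>
     (\<forall>x\<in>carrier A. h (mv_neg A x) = mv_neg B (h x))}"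

definition mv_isomorphic :: "('a, 'c) mv_scheme \<Rightarrow> ('b, 'd) mv_scheme \<Rightarrow> bool" where
  "mv_isomorphic A B \<longleftrightarrow> (\<exists>h\<in>mv_hom A B. bij_betw h (carrier A) (carrier B))"

definition mv_Gamma :: "('a, 'b) ulgroup_scheme \<Rightarrow> 'a mv" where
  "mv_Gamma G =
     \<lparr>carrier = {x \<in> carrier G. lg_le G \<one>\<^bsub>G\<^esub> x \<and> lg_le G x (lg_unit G)},
      mv_zero = \<one>\<^bsub>G\<^esub>,
      mv_plus = (\<lambda>x y. lg_meet G (lg_unit G) (x \<otimes>\<^bsub>G\<^esub> y)),
      mv_neg = (\<lambda>x. lg_unit G \<otimes>\<^bsub>G\<^esub> inv\<^bsub>G\<^esub> x)\<rparr>"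

text \<open>
  \<open>cube {..<m}\<close> is \<open>[0,1]\<^sup>m\<close> and \<open>cube UNIV\<close> is \<open>[0,1]\<^sup>\<omega>\<close>.  Coordinates are counted from 0, and points
  of \<open>[0,1]\<^sup>m\<close> are extensional (\<^const>\<open>undefined\<close> outside \<open>{..<m}\<close>), so that the topology of
  \<^typ>\<open>nat \<Rightarrow> real\<close> (the product topology) induces the usual one on \<open>cube {..<m}\<close>.
\<close>

definition cube :: "nat set \<Rightarrow> (nat \<Rightarrow> real) set" where
  "cube I = I \<rightarrow>\<^sub>E {0..1}"

definition mcnaughton :: "nat \<Rightarrow> ((nat \<Rightarrow> real) \<Rightarrow> real) \<Rightarrow> bool" where
  "mcnaughton m f \<longleftrightarrow>
     f \<in> cube {..<m} \<rightarrow> {0..1} \<and>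
     continuous_on (cube {..<m}) f \<and>
     (\<exists>(t::nat) (a :: nat \<Rightarrow> nat \<Rightarrow> int) (b :: nat \<Rightarrow> int).
        \<forall>x\<in>cube {..<m}. \<exists>j<t. f x = of_int (b j) + (\<Sum>i<m. of_int (a j i) * x i))"

text \<open>
  Functions on \<open>[0,1]\<^sup>\<omega>\<close> are represented extensionally (\<^const>\<open>undefined\<close> outside the cube), so that
  equality in the carrier is equality of functions on \<open>[0,1]\<^sup>\<omega>\<close>.
\<close>

definition mcn_omega :: "((nat \<Rightarrow> real) \<Rightarrow> real) mv" where
  "mcn_omega =
     \<lparr>carrier = {g \<in> cube UNIV \<rightarrow>\<^sub>E {0..1}.
        \<exists>m f (i :: nat \<Rightarrow> nat). mcnaughton m f \<and> strict_mono_on {..<m} i \<and>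
          (\<forall>x\<in>cube UNIV. g x = f (\<lambda>k\<in>{..<m}. x (i k)))},
      mv_zero = (\<lambda>x\<in>cube UNIV. 0),
      mv_plus = (\<lambda>g h. \<lambda>x\<in>cube UNIV. min 1 (g x + h x)),
      mv_neg = (\<lambda>g. \<lambda>x\<in>cube UNIV. 1 - g x)\<rparr>"

end

theory Submission
  imports Defs
begin

text \<open>
  Substituting \<open>0\<close> for the first coordinate and \<open>x\<^sub>n\<close> for \<open>x\<^bsub>n+1\<^esub>\<close> is an endomorphism of
  \<open>\<M>([0,1]\<^sup>\<omega>)\<close> that is onto but kills \<open>x\<^sub>0\<close>.  To transport it to a unital \<open>\<ell>\<close>-group, only the
  fullness of \<open>\<Gamma>\<close> is needed: an MV-homomorphism preserves the sums that stay below the unit, every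
  positive element is a sum of elements of the unit interval, and by Riesz decomposition the
  sum of the images does not depend on the chosen summands.  The resulting additive map respects the
  lattice operations because it preserves disjointness.  The group \<open>M\<close> itself is the group of
  continuous piecewise affine functions with integer coefficients in finitely many coordinates.
\<close>

section \<open>Unital lattice-ordered groups\<close>

text \<open>An MV-homomorphism sees only the unit interval, where the truncated sum hides the group
  sum. Two facts recover what is needed: \<open>x + y\<close> stays below the unit exactly when
  \<open>x\<close> lies below the negation of \<open>y\<close>, and both the order and disjointness
  inside the interval are equations between MV-operations. Disjointness is what settles the lattice
  operations: every element is a difference of two disjoint positive elements, the first of which is
  its positive part, and joins and meets can be written with positive parts and group operations
  alone. Surjectivity lifts summand by summand, and failure of injectivity is already visible in the
  unit interval, where the extension agrees with the given map. The endomorphism itself exists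
  because infinitely many coordinates can lose one and be renumbered without a gap. The comments
  below write the group additively.\<close>

lemma lattice_lg_orderI:
  assumes "\<And>x. x \<in> carrier G \<Longrightarrow> lg_le G x x"
    and "\<And>x y. \<lbrakk>x \<in> carrier G; y \<in> carrier G; lg_le G x y; lg_le G y x\<rbrakk> \<Longrightarrow> x = y"
    and "\<And>x y z. \<lbrakk>x \<in> carrier G; y \<in> carrier G; z \<in> carrier G; lg_le G x y; lg_le G y z\<rbrakk> \<Longrightarrow> lg_le G x z"
    and "\<And>x y. \<lbrakk>x \<in> carrier G; y \<in> carrier G\<rbrakk> \<Longrightarrow> \<exists>s\<in>carrier G. lg_le G x s \<and> lg_le G y s \<and>
           (\<forall>z\<in>carrier G. lg_le G x z \<longrightarrow> lg_le G y z \<longrightarrow> lg_le G s z)"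
    and "\<And>x y. \<lbrakk>x \<in> carrier G; y \<in> carrier G\<rbrakk> \<Longrightarrow> \<exists>s\<in>carrier G. lg_le G s x \<and> lg_le G s y \<and>
           (\<forall>z\<in>carrier G. lg_le G z x \<longrightarrow> lg_le G z y \<longrightarrow> lg_le G z s)"
  shows "lattice (lg_order G)"
proof -
  interpret partial_order "lg_order G"
    by unfold_locales (simp_all add: lg_order_def, (metis assms(1-3))+)
  show ?thesis
  proof
    fix x y assume "x \<in> carrier (lg_order G)" "y \<in> carrier (lg_order G)"
    then have xy: "x \<in> carrier G" "y \<in> carrier G" by (simp_all add: lg_order_def)
    obtain s where "s \<in> carrier G" "lg_le G x s" "lg_le G y s"
      "\<forall>z\<in>carrier G. lg_le G x z \<longrightarrow> lg_le G y z \<longrightarrow> lg_le G s z"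
      using assms(4)[OF xy] by blast
    then have "is_lub (lg_order G) s {x, y}"
      using xy by (intro least_UpperI) (auto simp: lg_order_def Upper_def)
    then show "\<exists>s. is_lub (lg_order G) s {x, y}" ..
    obtain s where "s \<in> carrier G" "lg_le G s x" "lg_le G s y"
      "\<forall>z\<in>carrier G. lg_le G z x \<longrightarrow> lg_le G z y \<longrightarrow> lg_le G z s"
      using assms(5)[OF xy] by blast
    then have "is_glb (lg_order G) s {x, y}"
      using xy by (intro greatest_LowerI) (auto simp: lg_order_def Lower_def)
    then show "\<exists>s. is_glb (lg_order G) s {x, y}" ..
  qed
qed

notation lg_le (infix "\<preceq>\<index>" 50)
notation lg_meet (infixl "\<triangle>\<index>" 70)
notation lg_join (infixl "\<nabla>\<index>" 65)
notation lg_unit ("\<upsilon>\<index>")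

abbreviation lg_disjoint (infix "\<bottom>\<index>" 50)
  where "lg_disjoint G x y \<equiv> lg_meet G x y = \<one>\<^bsub>G\<^esub>"

section \<open>Order, translations and lattice operations\<close>

context unital_l_group
begin

text \<open>Restates the library's lattice laws with \<open>carrier G\<close> and
  \<open>lg_le G\<close> in place of the fields of \<open>lg_order G\<close>, so that later proofs
  need not unfold that record.\<close>

lemma ord_refl [simp]: "x \<in> carrier G \<Longrightarrow> x \<preceq> x"
  and ord_antisym: "\<lbrakk>x \<preceq> y; y \<preceq> x; x \<in> carrier G; y \<in> carrier G\<rbrakk> \<Longrightarrow> x = y"
  and ord_trans: "\<lbrakk>x \<preceq> y; y \<preceq> z; x \<in> carrier G; y \<in> carrier G; z \<in> carrier G\<rbrakk> \<Longrightarrow> x \<preceq> z"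
  and jn_closed [simp]: "\<lbrakk>x \<in> carrier G; y \<in> carrier G\<rbrakk> \<Longrightarrow> x \<nabla> y \<in> carrier G"
  and jn_left: "\<lbrakk>x \<in> carrier G; y \<in> carrier G\<rbrakk> \<Longrightarrow> x \<preceq> x \<nabla> y"
  and jn_right: "\<lbrakk>x \<in> carrier G; y \<in> carrier G\<rbrakk> \<Longrightarrow> y \<preceq> x \<nabla> y"
  and jn_least: "\<lbrakk>x \<preceq> z; y \<preceq> z; x \<in> carrier G; y \<in> carrier G; z \<in> carrier G\<rbrakk> \<Longrightarrow> x \<nabla> y \<preceq> z"
  and mt_closed [simp]: "\<lbrakk>x \<in> carrier G; y \<in> carrier G\<rbrakk> \<Longrightarrow> x \<triangle> y \<in> carrier G"
  and mt_left: "\<lbrakk>x \<in> carrier G; y \<in> carrier G\<rbrakk> \<Longrightarrow> x \<triangle> y \<preceq> x"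
  and mt_right: "\<lbrakk>x \<in> carrier G; y \<in> carrier G\<rbrakk> \<Longrightarrow> x \<triangle> y \<preceq> y"
  and mt_greatest: "\<lbrakk>z \<preceq> x; z \<preceq> y; x \<in> carrier G; y \<in> carrier G; z \<in> carrier G\<rbrakk> \<Longrightarrow> z \<preceq> x \<triangle> y"
proof -
  interpret L: lattice "lg_order G" by (rule lattice_order)
  have [simp]: "carrier (lg_order G) = carrier G" "le (lg_order G) = lg_le G"
    by (simp_all add: lg_order_def)
  show "x \<in> carrier G \<Longrightarrow> x \<preceq> x"
    and "\<lbrakk>x \<preceq> y; y \<preceq> x; x \<in> carrier G; y \<in> carrier G\<rbrakk> \<Longrightarrow> x = y"
    and "\<lbrakk>x \<preceq> y; y \<preceq> z; x \<in> carrier G; y \<in> carrier G; z \<in> carrier G\<rbrakk> \<Longrightarrow> x \<preceq> z"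
    and "\<lbrakk>x \<in> carrier G; y \<in> carrier G\<rbrakk> \<Longrightarrow> x \<nabla> y \<in> carrier G"
    and "\<lbrakk>x \<in> carrier G; y \<in> carrier G\<rbrakk> \<Longrightarrow> x \<preceq> x \<nabla> y"
    and "\<lbrakk>x \<in> carrier G; y \<in> carrier G\<rbrakk> \<Longrightarrow> y \<preceq> x \<nabla> y"
    and "\<lbrakk>x \<preceq> z; y \<preceq> z; x \<in> carrier G; y \<in> carrier G; z \<in> carrier G\<rbrakk> \<Longrightarrow> x \<nabla> y \<preceq> z"
    and "\<lbrakk>x \<in> carrier G; y \<in> carrier G\<rbrakk> \<Longrightarrow> x \<triangle> y \<in> carrier G"
    and "\<lbrakk>x \<in> carrier G; y \<in> carrier G\<rbrakk> \<Longrightarrow> x \<triangle> y \<preceq> x"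
    and "\<lbrakk>x \<in> carrier G; y \<in> carrier G\<rbrakk> \<Longrightarrow> x \<triangle> y \<preceq> y"
    and "\<lbrakk>z \<preceq> x; z \<preceq> y; x \<in> carrier G; y \<in> carrier G; z \<in> carrier G\<rbrakk> \<Longrightarrow> z \<preceq> x \<triangle> y"
    using L.le_refl[of x] L.le_antisym[of x y] L.le_trans[of x y z] L.join_closed[of x y]
      L.join_left[of x y] L.join_right[of x y] L.join_le[of x z y] L.meet_closed[of x y]
      L.meet_left[of x y] L.meet_right[of x y] L.meet_le[of z x y]
    by auto
qed

lemma jn_eqI:
  assumes "x \<preceq> s" "y \<preceq> s" "\<And>z. \<lbrakk>z \<in> carrier G; x \<preceq> z; y \<preceq> z\<rbrakk> \<Longrightarrow> s \<preceq> z"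
    and "x \<in> carrier G" "y \<in> carrier G" "s \<in> carrier G"
  shows "x \<nabla> y = s"
  using assms by (intro ord_antisym) (auto simp: jn_left jn_right jn_least)

lemma mt_eqI:
  assumes "s \<preceq> x" "s \<preceq> y" "\<And>z. \<lbrakk>z \<in> carrier G; z \<preceq> x; z \<preceq> y\<rbrakk> \<Longrightarrow> z \<preceq> s"
    and "x \<in> carrier G" "y \<in> carrier G" "s \<in> carrier G"
  shows "x \<triangle> y = s"
  using assms by (intro ord_antisym) (auto simp: mt_left mt_right mt_greatest)

lemma unit_carrier [simp]: "\<upsilon> \<in> carrier G"
  by (rule unit_closed)

lemma inv_cancel1: "\<lbrakk>x \<in> carrier G; y \<in> carrier G\<rbrakk> \<Longrightarrow> x \<otimes> (inv x \<otimes> y) = y"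
  and inv_cancel2: "\<lbrakk>x \<in> carrier G; y \<in> carrier G\<rbrakk> \<Longrightarrow> inv x \<otimes> (x \<otimes> y) = y"
  and inv_cancel3: "\<lbrakk>x \<in> carrier G; y \<in> carrier G\<rbrakk> \<Longrightarrow> x \<otimes> inv y \<otimes> y = x"
  and inv_cancel4: "\<lbrakk>x \<in> carrier G; y \<in> carrier G\<rbrakk> \<Longrightarrow> x \<otimes> y \<otimes> inv y = x"
  by (simp_all add: m_assoc[symmetric]) (simp_all add: m_assoc)

lemmas inv_cancel [simp] = inv_cancel1 inv_cancel2 inv_cancel3 inv_cancel4

lemma mult_le_cancel_right [simp]:
  assumes "x \<in> carrier G" "y \<in> carrier G" "z \<in> carrier G"
  shows "x \<otimes> z \<preceq> y \<otimes> z \<longleftrightarrow> x \<preceq> y"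
  using translation_invariant[of "x \<otimes> z" "y \<otimes> z" "inv z"] translation_invariant[of x y z] assms
  by auto

lemma mult_le_cancel_left [simp]:
  assumes "x \<in> carrier G" "y \<in> carrier G" "z \<in> carrier G"
  shows "z \<otimes> x \<preceq> z \<otimes> y \<longleftrightarrow> x \<preceq> y"
  using mult_le_cancel_right[OF assms] assms by (simp add: m_comm[of z])

lemma le_mult_inv_iff:
  assumes "x \<in> carrier G" "y \<in> carrier G" "z \<in> carrier G"
  shows "x \<preceq> y \<otimes> inv z \<longleftrightarrow> x \<otimes> z \<preceq> y"
  using mult_le_cancel_right[of x "y \<otimes> inv z" z] assms by simp

lemma mult_inv_le_iff:
  assumes "x \<in> carrier G" "y \<in> carrier G" "z \<in> carrier G"
  shows "x \<otimes> inv z \<preceq> y \<longleftrightarrow> x \<preceq> y \<otimes> z"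
  using mult_le_cancel_right[of "x \<otimes> inv z" y z] assms by simp

lemma mult_mono_le:
  assumes "x \<preceq> y" "z \<preceq> w" "x \<in> carrier G" "y \<in> carrier G" "z \<in> carrier G" "w \<in> carrier G"
  shows "x \<otimes> z \<preceq> y \<otimes> w"
  using assms ord_trans[of "x \<otimes> z" "y \<otimes> z" "y \<otimes> w"] by simp

lemma mult_nonneg: "\<lbrakk>\<one> \<preceq> x; \<one> \<preceq> y; x \<in> carrier G; y \<in> carrier G\<rbrakk> \<Longrightarrow> \<one> \<preceq> x \<otimes> y"
  using mult_mono_le[of \<one> x \<one> y] by simp

lemma le_mult_right: "\<lbrakk>\<one> \<preceq> y; x \<in> carrier G; y \<in> carrier G\<rbrakk> \<Longrightarrow> x \<preceq> x \<otimes> y"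
  using mult_le_cancel_left[of \<one> y x] by simp

text \<open>Translation by \<open>z\<close> is an order automorphism, with translation by
  \<open>-z\<close> as inverse, so it carries least upper bounds to least upper bounds.\<close>

lemma jn_mult:
  assumes "x \<in> carrier G" "y \<in> carrier G" "z \<in> carrier G"
  shows "(x \<nabla> y) \<otimes> z = (x \<otimes> z) \<nabla> (y \<otimes> z)"
proof (rule jn_eqI[symmetric])
  fix w assume w: "w \<in> carrier G" "x \<otimes> z \<preceq> w" "y \<otimes> z \<preceq> w"
  then have "x \<nabla> y \<preceq> w \<otimes> inv z"
    using assms by (intro jn_least) (simp_all add: le_mult_inv_iff)
  then show "(x \<nabla> y) \<otimes> z \<preceq> w"
    using assms w by (simp add: le_mult_inv_iff)
qed (use assms in \<open>auto simp: jn_left jn_right\<close>)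

lemma mt_mult:
  assumes "x \<in> carrier G" "y \<in> carrier G" "z \<in> carrier G"
  shows "(x \<triangle> y) \<otimes> z = (x \<otimes> z) \<triangle> (y \<otimes> z)"
proof (rule mt_eqI[symmetric])
  fix w assume w: "w \<in> carrier G" "w \<preceq> x \<otimes> z" "w \<preceq> y \<otimes> z"
  then have "w \<otimes> inv z \<preceq> x \<triangle> y"
    using assms by (intro mt_greatest) (simp_all add: mult_inv_le_iff)
  then show "w \<preceq> (x \<triangle> y) \<otimes> z"
    using assms w by (simp add: mult_inv_le_iff)
qed (use assms in \<open>auto simp: mt_left mt_right\<close>)

text \<open>The order-reversing map sending \<open>z\<close> to \<open>x + y - z\<close> swaps
  \<open>x\<close> and \<open>y\<close>, hence turns their join into their meet. Through this
  identity any additive map that preserves joins preserves meets.\<close>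

lemma mt_jn_mult:
  assumes "x \<in> carrier G" "y \<in> carrier G"
  shows "x \<triangle> y = x \<otimes> y \<otimes> inv (x \<nabla> y)"
proof (rule mt_eqI)
  fix z assume z: "z \<in> carrier G" "z \<preceq> x" "z \<preceq> y"
  have "x \<otimes> z \<preceq> x \<otimes> y" "y \<otimes> z \<preceq> x \<otimes> y"
    using assms z m_comm[of y z] by simp_all
  then have "(x \<nabla> y) \<otimes> z \<preceq> x \<otimes> y"
    using assms z jn_least by (simp add: jn_mult)
  then show "z \<preceq> x \<otimes> y \<otimes> inv (x \<nabla> y)"
    using assms z by (simp add: le_mult_inv_iff m_comm[of z])
next
  show "x \<otimes> y \<otimes> inv (x \<nabla> y) \<preceq> x"
    using assms by (simp add: mult_inv_le_iff jn_right)
  show "x \<otimes> y \<otimes> inv (x \<nabla> y) \<preceq> y"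
    using assms by (simp add: mult_inv_le_iff jn_left m_comm[of x y])
qed (use assms in auto)

section \<open>Positive and negative parts\<close>

lemma jn_eq_pos_part:
  assumes "x \<in> carrier G" "y \<in> carrier G"
  shows "x \<nabla> y = ((x \<otimes> inv y) \<nabla> \<one>) \<otimes> y"
  using assms by (simp add: jn_mult)

text \<open>Since the meet of \<open>p\<close> and \<open>q\<close> vanishes, their sum equals their
  join; translating that join by \<open>-q\<close> gives the claim.\<close>

lemma pos_part_unique:
  assumes "p \<bottom> q" "p \<in> carrier G" "q \<in> carrier G"
  shows "(p \<otimes> inv q) \<nabla> \<one> = p"
proof -
  have "p \<otimes> q \<otimes> inv (p \<nabla> q) = \<one>"
    using mt_jn_mult[of p q] assms by simp
  then have "p \<otimes> q = p \<nabla> q"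
    using inv_cancel3[of "p \<otimes> q" "p \<nabla> q"] assms by (simp del: inv_cancel)
  then have "((p \<otimes> inv q) \<nabla> \<one>) \<otimes> q = p \<otimes> q"
    using assms by (simp add: jn_mult)
  then show ?thesis using assms by simp
qed

lemma pos_neg_parts:
  assumes "x \<in> carrier G"
  obtains p q where "p \<in> carrier G" "q \<in> carrier G" "p \<bottom> q" "x = p \<otimes> inv q"
proof
  let ?p = "x \<nabla> \<one>" and ?q = "(x \<nabla> \<one>) \<otimes> inv x"
  show "?p \<bottom> ?q"
  proof (rule mt_eqI)
    fix d assume d: "d \<in> carrier G" "d \<preceq> ?p" "d \<preceq> ?q"
    \<comment> \<open>A common lower bound \<open>d\<close> of the two parts makes
      \<open>?p - d\<close> another upper bound of \<open>x\<close> and zero; as \<open>?p\<close>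
      is the least one, \<open>d\<close> cannot exceed zero.\<close>
    have "x \<nabla> \<one> \<preceq> ?p \<otimes> inv d"
      using d assms m_comm[of x d] by (intro jn_least) (simp_all add: le_mult_inv_iff)
    then show "d \<preceq> \<one>"
      using d assms mult_le_cancel_left[of d \<one> ?p] by (simp add: le_mult_inv_iff)
  qed (use assms in \<open>auto simp: le_mult_inv_iff jn_left jn_right\<close>)
qed (use assms in \<open>auto simp: inv_mult\<close>)

lemma disjoint_nonneg:
  assumes "p \<bottom> q" "p \<in> carrier G" "q \<in> carrier G"
  shows "\<one> \<preceq> p" "\<one> \<preceq> q"
  using assms mt_left[of p q] mt_right[of p q] by auto

lemma carrier_mv_Gamma: "carrier (mv_Gamma G) = {x \<in> carrier G. \<one> \<preceq> x \<and> x \<preceq> \<upsilon>}"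
  by (simp add: mv_Gamma_def)

section \<open>Sums of lists and Riesz decomposition\<close>

abbreviation lprod where "lprod xs \<equiv> foldr (\<otimes>) xs \<one>"

lemma lprod_closed [simp]: "set xs \<subseteq> carrier G \<Longrightarrow> lprod xs \<in> carrier G"
  by (induction xs) auto

lemma lprod_append:
  "\<lbrakk>set xs \<subseteq> carrier G; set ys \<subseteq> carrier G\<rbrakk> \<Longrightarrow> lprod (xs @ ys) = lprod xs \<otimes> lprod ys"
  by (induction xs) (auto simp: m_assoc)

lemma lprod_nonneg:
  "\<lbrakk>set xs \<subseteq> carrier G; \<forall>x\<in>set xs. \<one> \<preceq> x\<rbrakk> \<Longrightarrow> \<one> \<preceq> lprod xs"
  by (induction xs) (auto intro: mult_nonneg)

lemma lprod_ge:
  "\<lbrakk>set xs \<subseteq> carrier G; \<forall>x\<in>set xs. \<one> \<preceq> x; y \<in> set xs\<rbrakk> \<Longrightarrow> y \<preceq> lprod xs"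
proof (induction xs)
  case (Cons x xs)
  show ?case
  proof (cases "y = x")
    case True
    then show ?thesis using Cons.prems lprod_nonneg[of xs] by (simp add: le_mult_right)
  next
    case False
    then have "y \<preceq> lprod xs" "y \<in> carrier G" using Cons by auto
    then show ?thesis using Cons.prems mult_mono_le[of \<one> x y "lprod xs"] by simp
  qed
qed simp

text \<open>The meet of \<open>a\<close> and \<open>b\<close> is the largest share of
  \<open>a\<close> that fits below \<open>b\<close>. The rest fits below \<open>c\<close> because
  \<open>a - c\<close> lies below both \<open>a\<close> and \<open>b\<close>.\<close>

lemma riesz_decomposition:
  assumes "\<one> \<preceq> a" "a \<preceq> b \<otimes> c" "\<one> \<preceq> b" "\<one> \<preceq> c"
    and [simp]: "a \<in> carrier G" "b \<in> carrier G" "c \<in> carrier G"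
  obtains a1 a2 where "a1 \<in> carrier G" "a2 \<in> carrier G" "a = a1 \<otimes> a2"
    "\<one> \<preceq> a1" "a1 \<preceq> b" "\<one> \<preceq> a2" "a2 \<preceq> c"
proof
  let ?a1 = "a \<triangle> b" and ?a2 = "a \<otimes> inv (a \<triangle> b)"
  show "?a1 \<in> carrier G" "?a2 \<in> carrier G" "\<one> \<preceq> ?a1" "?a1 \<preceq> b" "\<one> \<preceq> ?a2" "a = ?a1 \<otimes> ?a2"
    using assms by (auto simp: mt_greatest mt_left mt_right le_mult_inv_iff m_comm[of "a \<triangle> b"])
  have "a \<otimes> inv c \<preceq> a \<triangle> b"
    using assms by (intro mt_greatest) (auto simp: mult_inv_le_iff le_mult_right)
  then show "?a2 \<preceq> c" by (simp add: mult_inv_le_iff m_comm[of c])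
qed

text \<open>Splits off the share of the head by the binary case and recurses on the rest. Lists
  allow repeated summands, and \<open>list_all2\<close> pairs each piece with the summand above
  it.\<close>

lemma riesz_decomposition_list:
  assumes "set ys \<subseteq> carrier G" "\<forall>y\<in>set ys. \<one> \<preceq> y" "\<one> \<preceq> a" "a \<preceq> lprod ys" "a \<in> carrier G"
  shows "\<exists>zs. list_all2 (\<lambda>z y. z \<in> carrier G \<and> \<one> \<preceq> z \<and> z \<preceq> y) zs ys \<and> a = lprod zs"
  using assms
proof (induction ys arbitrary: a)
  case Nil
  then show ?case by (auto intro: ord_antisym)
next
  case (Cons y ys)
  have "\<one> \<preceq> y" "\<one> \<preceq> lprod ys" "a \<preceq> y \<otimes> lprod ys" "y \<in> carrier G" "lprod ys \<in> carrier G"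
    using Cons.prems lprod_nonneg by auto
  with Cons.prems obtain a1 a2 where a: "a1 \<in> carrier G" "a2 \<in> carrier G" "a = a1 \<otimes> a2"
    "\<one> \<preceq> a1" "a1 \<preceq> y" "\<one> \<preceq> a2" "a2 \<preceq> lprod ys"
    by (metis riesz_decomposition)
  then obtain zs where "list_all2 (\<lambda>z y. z \<in> carrier G \<and> \<one> \<preceq> z \<and> z \<preceq> y) zs ys" "a2 = lprod zs"
    using Cons.IH[of a2] Cons.prems by auto
  then show ?case using a by (intro exI[of _ "a1 # zs"]) simp
qed

text \<open>Decompose a positive common lower bound along \<open>xs\<close>: each piece lies below
  some member of \<open>xs\<close> and also below \<open>y\<close>, so it is zero, and with the
  pieces their sum vanishes.\<close>

lemma disjoint_lprod:
  assumes "set xs \<subseteq> carrier G" "\<forall>x\<in>set xs. x \<bottom> y" "\<one> \<preceq> y" "y \<in> carrier G"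
  shows "lprod xs \<bottom> y"
proof (rule mt_eqI)
  have pos: "\<forall>x\<in>set xs. \<one> \<preceq> x" using assms disjoint_nonneg by blast
  then show "\<one> \<preceq> lprod xs" using assms lprod_nonneg by blast
  fix d assume d: "d \<in> carrier G" "d \<preceq> lprod xs" "d \<preceq> y"
  \<comment> \<open>Riesz decomposition asks for a positive element; joining \<open>d\<close> with
    zero keeps it below both bounds.\<close>
  let ?d = "d \<nabla> \<one>"
  have D: "?d \<in> carrier G" "\<one> \<preceq> ?d" "?d \<preceq> lprod xs" "?d \<preceq> y"
    using d assms \<open>\<one> \<preceq> lprod xs\<close> by (auto simp: jn_right jn_least)
  then obtain zs where zs: "list_all2 (\<lambda>z y. z \<in> carrier G \<and> \<one> \<preceq> z \<and> z \<preceq> y) zs xs" "?d = lprod zs"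
    using riesz_decomposition_list[of xs ?d] assms pos by auto
  have zc: "set zs \<subseteq> carrier G" "\<forall>z\<in>set zs. \<one> \<preceq> z"
    using zs(1) by (auto simp: list_all2_conv_all_nth in_set_conv_nth)
  have "\<forall>z\<in>set zs. z = \<one>"
  proof
    fix z assume z: "z \<in> set zs"
    then obtain i where "i < length zs" "z = zs ! i" by (auto simp: in_set_conv_nth)
    then have "xs ! i \<in> set xs" "z \<preceq> xs ! i"
      using zs(1) by (auto simp: list_all2_conv_all_nth)
    then obtain x where x: "x \<in> set xs" "z \<preceq> x" by blast
    have "z \<preceq> y" using lprod_ge[OF zc z] D z zc zs(2) assms ord_trans[of z ?d y] by auto
    then have "z \<preceq> x \<triangle> y" using x z zc assms by (intro mt_greatest) auto
    then show "z = \<one>" using x z zc assms by (auto intro: ord_antisym)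
  qed
  then have "lprod zs = \<one>" by (induction zs) auto
  then show "d \<preceq> \<one>" using zs(2) jn_left[of d \<one>] d by simp
qed (use assms in auto)

lemma mt_comm: "x \<triangle> y = y \<triangle> x"
  by (rule meet_comm)

lemma disjoint_lprods:
  assumes "set xs \<subseteq> carrier G" "set ys \<subseteq> carrier G"
    and "\<forall>x\<in>set xs. \<one> \<preceq> x" "\<forall>y\<in>set ys. \<one> \<preceq> y" "\<forall>x\<in>set xs. \<forall>y\<in>set ys. x \<bottom> y"
  shows "lprod xs \<bottom> lprod ys"
proof (rule disjoint_lprod)
  show "\<forall>x\<in>set xs. x \<bottom> lprod ys"
    using assms disjoint_lprod[of ys] mt_comm by (metis subsetD)
qed (use assms lprod_nonneg in auto)

lemma pow_unit_nonneg: "\<one> \<preceq> \<upsilon> [^] (n::nat)"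
  by (induction n) (auto simp: mult_nonneg unit_nonneg)

text \<open>The multiple will be the length of a list of copies of the unit, so it must be a natural
  number. A negative integer multiple of the unit lies below zero, and then the multiple 0 already
  dominates \<open>x\<close>.\<close>

lemma nonneg_dominated:
  assumes "x \<in> carrier G" "\<one> \<preceq> x"
  shows "\<exists>n::nat. x \<preceq> \<upsilon> [^] n"
proof -
  obtain k :: int where k: "x \<preceq> \<upsilon> [^] k" using unit_dominates assms by blast
  show ?thesis
  proof (cases k)
    case (nonneg n)
    then have "x \<preceq> \<upsilon> [^] n" using k by (simp add: int_pow_int)
    then show ?thesis ..
  next
    case (neg n)
    define m where "m = nat (- k)"
    have "k < 0" using neg by simp
    then have "\<upsilon> [^] k = inv (\<upsilon> [^] m)" by (simp only: int_pow_def2 m_def if_True)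
    moreover have "inv (\<upsilon> [^] m) \<preceq> \<one>"
      using mult_inv_le_iff[of \<one> \<one> "\<upsilon> [^] m"] pow_unit_nonneg[of m] by simp
    ultimately have "\<upsilon> [^] k \<preceq> \<one>" by simp
    then have "x \<preceq> \<upsilon> [^] (0::nat)" using k assms ord_trans[of x "\<upsilon> [^] k" \<one>] by simp
    then show ?thesis by blast
  qed
qed

lemma lprod_replicate_unit: "lprod (replicate n \<upsilon>) = \<upsilon> [^] n"
  by (induction n) (auto simp: m_comm)

text \<open>Some multiple \<open>n\<close> of the unit dominates \<open>x\<close>; decomposing
  \<open>x\<close> along the list of \<open>n\<close> copies of the unit yields summands in the unit
  interval.\<close>

lemma nonneg_eq_lprod:
  assumes "x \<in> carrier G" "\<one> \<preceq> x"
  shows "\<exists>xs. set xs \<subseteq> carrier (mv_Gamma G) \<and> x = lprod xs"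
proof -
  obtain n :: nat where "x \<preceq> \<upsilon> [^] n"
    using nonneg_dominated[OF assms] by blast
  then have "x \<preceq> lprod (replicate n \<upsilon>)"
    by (simp only: lprod_replicate_unit)
  then obtain zs where "list_all2 (\<lambda>z y. z \<in> carrier G \<and> \<one> \<preceq> z \<and> z \<preceq> y) zs (replicate n \<upsilon>)"
      "x = lprod zs"
    using riesz_decomposition_list[of "replicate n \<upsilon>" x] assms unit_nonneg set_replicate_conv_if[of n \<upsilon>]
    by (auto simp del: foldr_replicate split: if_splits)
  then show ?thesis
    by (intro exI[of _ zs])
      (auto simp: list_all2_conv_all_nth in_set_conv_nth carrier_mv_Gamma)
qed

lemma mult_inv_eqI:
  assumes "a \<otimes> d = b \<otimes> c" "a \<in> carrier G" "b \<in> carrier G" "c \<in> carrier G" "d \<in> carrier G"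
  shows "a \<otimes> inv c = b \<otimes> inv d"
proof -
  have "a = b \<otimes> c \<otimes> inv d" using assms inv_cancel4[of a d] by simp
  also have "\<dots> = b \<otimes> inv d \<otimes> c" using assms by (simp add: m_ac)
  finally show ?thesis using assms by simp
qed

lemma mult_mult_swap:
  "\<lbrakk>a \<in> carrier G; b \<in> carrier G; c \<in> carrier G; d \<in> carrier G\<rbrakk>
    \<Longrightarrow> (a \<otimes> b) \<otimes> (c \<otimes> d) = (a \<otimes> c) \<otimes> (b \<otimes> d)"
  by (simp add: m_ac)

lemma mult_inv_mult:
  assumes "a \<in> carrier G" "b \<in> carrier G" "c \<in> carrier G" "d \<in> carrier G"
  shows "(a \<otimes> inv b) \<otimes> (c \<otimes> inv d) = (a \<otimes> c) \<otimes> inv (b \<otimes> d)"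
  using assms by (simp add: inv_mult m_ac)

lemma mt_absorb1:
  assumes "x \<preceq> y" "x \<in> carrier G" "y \<in> carrier G"
  shows "x \<triangle> y = x"
  using assms by (intro mt_eqI) auto

section \<open>The MV-operations on the unit interval\<close>

lemma mv_neg_closed: "x \<in> carrier (mv_Gamma G) \<Longrightarrow> mv_neg (mv_Gamma G) x \<in> carrier (mv_Gamma G)"
  by (auto simp: mv_Gamma_def le_mult_inv_iff mult_inv_le_iff le_mult_right)

lemma mv_plus_closed:
  "\<lbrakk>x \<in> carrier (mv_Gamma G); y \<in> carrier (mv_Gamma G)\<rbrakk>
    \<Longrightarrow> mv_plus (mv_Gamma G) x y \<in> carrier (mv_Gamma G)"
  by (auto simp: mv_Gamma_def unit_nonneg mult_nonneg mt_left intro: mt_greatest)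

lemma one_in_Gamma: "\<one> \<in> carrier (mv_Gamma G)"
  and unit_in_Gamma: "\<upsilon> \<in> carrier (mv_Gamma G)"
  by (simp_all add: carrier_mv_Gamma unit_nonneg)

text \<open>Turns the order into an equation between MV-operations, so that every MV-homomorphism is
  monotone.\<close>

lemma le_iff_mv_plus:
  assumes "x \<in> carrier (mv_Gamma G)" "y \<in> carrier (mv_Gamma G)"
  shows "x \<preceq> y \<longleftrightarrow> mv_plus (mv_Gamma G) (mv_neg (mv_Gamma G) x) y = \<upsilon>"
proof -
  have xy: "x \<in> carrier G" "y \<in> carrier G" using assms by (auto simp: carrier_mv_Gamma)
  have "\<upsilon> \<triangle> (\<upsilon> \<otimes> inv x \<otimes> y) = \<upsilon> \<longleftrightarrow> \<upsilon> \<preceq> \<upsilon> \<otimes> inv x \<otimes> y"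
    using xy mt_right[of \<upsilon> "\<upsilon> \<otimes> inv x \<otimes> y"] mt_absorb1 by auto
  also have "\<dots> \<longleftrightarrow> \<one> \<preceq> y \<otimes> inv x"
    using xy mult_le_cancel_left[of \<one> "y \<otimes> inv x" \<upsilon>] by (simp add: m_ac)
  finally show ?thesis using xy by (simp add: mv_Gamma_def le_mult_inv_iff)
qed

text \<open>Translating \<open>x\<close> and \<open>y\<close> by the negation of \<open>x\<close>
  shows that the truncated sum of this negation and \<open>y\<close> exceeds the negation by exactly
  the meet of \<open>x\<close> and \<open>y\<close>. Disjointness thus becomes an equation that
  MV-homomorphisms preserve.\<close>

lemma disjoint_iff_mv_plus:
  assumes "x \<in> carrier (mv_Gamma G)" "y \<in> carrier (mv_Gamma G)"
  shows "x \<bottom> y \<longleftrightarrow>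
    mv_plus (mv_Gamma G) (mv_neg (mv_Gamma G) x) y = mv_neg (mv_Gamma G) x"
proof -
  have xy: "x \<in> carrier G" "y \<in> carrier G" using assms by (auto simp: carrier_mv_Gamma)
  have "\<upsilon> \<triangle> (\<upsilon> \<otimes> inv x \<otimes> y) = (x \<triangle> y) \<otimes> (\<upsilon> \<otimes> inv x)"
    using xy by (simp add: mt_mult m_comm[of x] m_comm[of y])
  then show ?thesis using xy by (simp add: mv_Gamma_def)
qed

lemma mv_plus_eq_mult:
  assumes "x \<in> carrier (mv_Gamma G)" "y \<in> carrier (mv_Gamma G)" "x \<otimes> y \<preceq> \<upsilon>"
  shows "mv_plus (mv_Gamma G) x y = x \<otimes> y"
  using assms mt_absorb1[of "x \<otimes> y" \<upsilon>] mt_comm[of "x \<otimes> y" \<upsilon>]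
  by (simp add: mv_Gamma_def)

text \<open>Says when truncation is inactive, in terms of the order and negation only, so the
  condition passes through an MV-homomorphism.\<close>

lemma mult_le_unit_iff:
  assumes "x \<in> carrier (mv_Gamma G)" "y \<in> carrier (mv_Gamma G)"
  shows "x \<otimes> y \<preceq> \<upsilon> \<longleftrightarrow> x \<preceq> mv_neg (mv_Gamma G) y"
  using assms by (simp add: mv_Gamma_def le_mult_inv_iff)

lemma Gamma_subset: "set xs \<subseteq> carrier (mv_Gamma G) \<Longrightarrow> set xs \<subseteq> carrier G"
  and Gamma_nonneg: "set xs \<subseteq> carrier (mv_Gamma G) \<Longrightarrow> \<forall>x\<in>set xs. \<one> \<preceq> x"
  by (auto simp: carrier_mv_Gamma)

end

section \<open>Extending MV-homomorphisms to unital lattice-ordered groups\<close>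

locale mv_hom_extension = dom: unital_l_group G + cod: unital_l_group H
  for G (structure) and H (structure) +
  fixes f
  assumes f_hom: "f \<in> mv_hom (mv_Gamma G) (mv_Gamma H)"
begin

lemma f_closed: "x \<in> carrier (mv_Gamma G) \<Longrightarrow> f x \<in> carrier (mv_Gamma H)"
  and f_plus: "\<lbrakk>x \<in> carrier (mv_Gamma G); y \<in> carrier (mv_Gamma G)\<rbrakk>
    \<Longrightarrow> f (mv_plus (mv_Gamma G) x y) = mv_plus (mv_Gamma H) (f x) (f y)"
  and f_neg: "x \<in> carrier (mv_Gamma G) \<Longrightarrow> f (mv_neg (mv_Gamma G) x) = mv_neg (mv_Gamma H) (f x)"
  using f_hom by (auto simp: mv_hom_def)

lemma f_one: "f \<one> = \<one>\<^bsub>H\<^esub>"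
  using f_hom by (simp add: mv_hom_def mv_Gamma_def)

lemma f_unit: "f \<upsilon> = \<upsilon>\<^bsub>H\<^esub>"
  using f_neg[OF dom.one_in_Gamma] f_one by (simp add: mv_Gamma_def)

lemma f_mono:
  assumes "x \<in> carrier (mv_Gamma G)" "y \<in> carrier (mv_Gamma G)" "x \<preceq> y"
  shows "f x \<preceq>\<^bsub>H\<^esub> f y"
  using assms dom.le_iff_mv_plus[of x y] cod.le_iff_mv_plus[of "f x" "f y"] f_unit
    f_plus[of "mv_neg (mv_Gamma G) x" y] f_neg[of x]
  by (simp add: f_closed dom.mv_neg_closed)

lemma f_disjoint:
  assumes "x \<in> carrier (mv_Gamma G)" "y \<in> carrier (mv_Gamma G)" "x \<bottom> y"
  shows "f x \<bottom>\<^bsub>H\<^esub> f y"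
  using assms dom.disjoint_iff_mv_plus[of x y] cod.disjoint_iff_mv_plus[of "f x" "f y"]
    f_plus[of "mv_neg (mv_Gamma G) x" y] f_neg[of x]
  by (simp add: f_closed dom.mv_neg_closed)

text \<open>The hypothesis becomes an inequality between \<open>x\<close> and the negation of
  \<open>y\<close>. Monotonicity carries it to \<open>H\<close>, so truncation is inactive on both
  sides and the MV-sums are group sums.\<close>

lemma f_mult:
  assumes "x \<in> carrier (mv_Gamma G)" "y \<in> carrier (mv_Gamma G)" "x \<otimes> y \<preceq> \<upsilon>"
  shows "f (x \<otimes> y) = f x \<otimes>\<^bsub>H\<^esub> f y"
proof -
  have "x \<preceq> mv_neg (mv_Gamma G) y" using assms dom.mult_le_unit_iff by simp
  then have "f x \<preceq>\<^bsub>H\<^esub> mv_neg (mv_Gamma H) (f y)"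
    using f_mono f_neg assms dom.mv_neg_closed by metis
  then have "f x \<otimes>\<^bsub>H\<^esub> f y \<preceq>\<^bsub>H\<^esub> \<upsilon>\<^bsub>H\<^esub>"
    using cod.mult_le_unit_iff assms f_closed by simp
  then show ?thesis
    using f_plus[of x y] dom.mv_plus_eq_mult[of x y] cod.mv_plus_eq_mult[of "f x" "f y"] assms f_closed
    by simp
qed

section \<open>Independence of the chosen summands\<close>

lemma map_f_closed: "set xs \<subseteq> carrier (mv_Gamma G) \<Longrightarrow> set (map f xs) \<subseteq> carrier (mv_Gamma H)"
  using f_closed by auto

lemma lprod_map_f_closed [simp]:
  "set xs \<subseteq> carrier (mv_Gamma G) \<Longrightarrow> cod.lprod (map f xs) \<in> carrier H"
  by (rule cod.lprod_closed[OF cod.Gamma_subset[OF map_f_closed]])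

text \<open>The summands are positive, so every tail of the list has its sum below the unit too and
  additivity applies at each step.\<close>

lemma f_lprod:
  "\<lbrakk>set xs \<subseteq> carrier (mv_Gamma G); dom.lprod xs \<preceq> \<upsilon>\<rbrakk>
    \<Longrightarrow> f (dom.lprod xs) = cod.lprod (map f xs)"
proof (induction xs)
  case Nil
  then show ?case by (simp add: f_one)
next
  case (Cons x xs)
  have xs: "set xs \<subseteq> carrier G" "\<one> \<preceq> dom.lprod xs" "x \<in> carrier G" "\<one> \<preceq> x"
    using Cons.prems dom.Gamma_subset[of xs] dom.Gamma_nonneg[of xs] dom.lprod_nonneg[of xs]
    by (auto simp: dom.carrier_mv_Gamma)
  then have "dom.lprod xs \<preceq> dom.lprod (x # xs)"
    using dom.le_mult_right[of x "dom.lprod xs"] by (simp add: dom.m_comm)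
  then have le: "dom.lprod xs \<preceq> \<upsilon>"
    using Cons.prems xs dom.ord_trans[of "dom.lprod xs" "dom.lprod (x # xs)" \<upsilon>] by simp
  then have "dom.lprod xs \<in> carrier (mv_Gamma G)"
    using xs by (simp add: dom.carrier_mv_Gamma)
  then show ?case using Cons le f_mult[of x "dom.lprod xs"] by simp
qed

text \<open>The list \<open>ws\<close> collects the remainders \<open>y - z\<close>. Each
  \<open>y\<close> is below the unit, so \<open>f\<close> is additive on \<open>z\<close> and its
  remainder, and the sums of images split as the sums do. This is the subtraction step in the
  uniqueness proof.\<close>

lemma split_lprod:
  assumes "list_all2 (\<lambda>z y. z \<in> carrier G \<and> \<one> \<preceq> z \<and> z \<preceq> y) zs ys" "set ys \<subseteq> carrier (mv_Gamma G)"
  shows "\<exists>ws. set zs \<subseteq> carrier (mv_Gamma G) \<and> set ws \<subseteq> carrier (mv_Gamma G) \<and>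
     dom.lprod ys = dom.lprod zs \<otimes> dom.lprod ws \<and>
     cod.lprod (map f ys) = cod.lprod (map f zs) \<otimes>\<^bsub>H\<^esub> cod.lprod (map f ws)"
  using assms
proof (induction rule: list_all2_induct)
  case Nil
  then show ?case by (intro exI[of _ "[]"]) simp
next
  case (Cons z zs y ys)
  then obtain ws where ws: "set zs \<subseteq> carrier (mv_Gamma G)" "set ws \<subseteq> carrier (mv_Gamma G)"
    "dom.lprod ys = dom.lprod zs \<otimes> dom.lprod ws"
    "cod.lprod (map f ys) = cod.lprod (map f zs) \<otimes>\<^bsub>H\<^esub> cod.lprod (map f ws)"
    by auto
  let ?w = "y \<otimes> inv z"
  have y: "y \<in> carrier G" "\<one> \<preceq> y" "y \<preceq> \<upsilon>" "z \<in> carrier G" "\<one> \<preceq> z" "z \<preceq> y"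
    using Cons by (auto simp: dom.carrier_mv_Gamma)
  have "?w \<preceq> y" using y by (simp add: dom.mult_inv_le_iff dom.le_mult_right)
  then have "?w \<preceq> \<upsilon>" "z \<preceq> \<upsilon>"
    using y dom.ord_trans[of ?w y \<upsilon>] dom.ord_trans[of z y \<upsilon>] by auto
  then have zw: "?w \<in> carrier (mv_Gamma G)" "z \<in> carrier (mv_Gamma G)"
    using y by (auto simp: dom.carrier_mv_Gamma dom.le_mult_inv_iff)
  have yzw: "y = z \<otimes> ?w" using y by (simp add: dom.m_comm[of z])
  have fyzw: "f y = f z \<otimes>\<^bsub>H\<^esub> f ?w" using f_mult[OF zw(2,1)] yzw y by simp
  have c: "dom.lprod zs \<in> carrier G" "dom.lprod ws \<in> carrier G" "?w \<in> carrier G"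
    "f z \<in> carrier H" "f ?w \<in> carrier H"
    using ws y f_closed[OF zw(1)] f_closed[OF zw(2)] dom.Gamma_subset
    by (auto simp: cod.carrier_mv_Gamma)
  have "dom.lprod (y # ys) = (z \<otimes> ?w) \<otimes> (dom.lprod zs \<otimes> dom.lprod ws)"
    using ws yzw by simp
  also have "\<dots> = dom.lprod (z # zs) \<otimes> dom.lprod (?w # ws)"
    using c y dom.mult_mult_swap[of z ?w "dom.lprod zs" "dom.lprod ws"] by simp
  finally have 1: "dom.lprod (y # ys) = dom.lprod (z # zs) \<otimes> dom.lprod (?w # ws)" .
  have 2: "cod.lprod (map f (y # ys)) = cod.lprod (map f (z # zs)) \<otimes>\<^bsub>H\<^esub> cod.lprod (map f (?w # ws))"
    using c ws by (simp add: fyzw cod.m_ac)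
  show ?case
    by (rule exI[of _ "?w # ws"]) (use ws zw 1 2 in \<open>simp del: foldr.simps\<close>)
qed

text \<open>The head \<open>x\<close> lies below the sum of \<open>ys\<close> and is decomposed
  along \<open>ys\<close> into \<open>zs\<close>. Cancelling \<open>x\<close> leaves the remainders
  \<open>ws\<close> with the same sum as the tail, so the induction hypothesis compares the tail
  with \<open>ws\<close>; this is why \<open>ys\<close> is arbitrary.\<close>

lemma lprod_map_f_unique:
  "\<lbrakk>set xs \<subseteq> carrier (mv_Gamma G); set ys \<subseteq> carrier (mv_Gamma G); dom.lprod xs = dom.lprod ys\<rbrakk>
    \<Longrightarrow> cod.lprod (map f xs) = cod.lprod (map f ys)"
proof (induction xs arbitrary: ys)
  case Nil
  then have "dom.lprod ys = \<one>" by simp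
  then show ?case using f_lprod[of ys] Nil dom.unit_nonneg f_one by simp
next
  case (Cons x xs)
  have x: "x \<in> carrier G" "\<one> \<preceq> x" "x \<preceq> \<upsilon>" using Cons.prems by (auto simp: dom.carrier_mv_Gamma)
  have "x \<preceq> dom.lprod (x # xs)"
    by (rule dom.lprod_ge[OF dom.Gamma_subset dom.Gamma_nonneg]) (use Cons.prems in auto)
  then obtain zs where zs: "list_all2 (\<lambda>z y. z \<in> carrier G \<and> \<one> \<preceq> z \<and> z \<preceq> y) zs ys" "x = dom.lprod zs"
    using dom.riesz_decomposition_list[OF dom.Gamma_subset dom.Gamma_nonneg, of ys x] Cons.prems x
    by auto
  then obtain ws where ws: "set zs \<subseteq> carrier (mv_Gamma G)" "set ws \<subseteq> carrier (mv_Gamma G)"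
    "dom.lprod ys = dom.lprod zs \<otimes> dom.lprod ws"
    "cod.lprod (map f ys) = cod.lprod (map f zs) \<otimes>\<^bsub>H\<^esub> cod.lprod (map f ws)"
    using split_lprod Cons.prems by blast
  have "x \<otimes> dom.lprod xs = x \<otimes> dom.lprod ws" using Cons.prems zs ws by simp
  then have "dom.lprod xs = dom.lprod ws"
    using Cons.prems ws x dom.Gamma_subset by simp
  then have "cod.lprod (map f xs) = cod.lprod (map f ws)"
    using Cons ws by simp
  \<comment> \<open>The pieces \<open>zs\<close> add up to \<open>x\<close>, which is below the
    unit, so additivity inside the interval suffices here.\<close>
  moreover have "f x = cod.lprod (map f zs)"
    using f_lprod[of zs] ws zs x by simp
  ultimately show ?case using ws by simp
qed

section \<open>Extension to positive elements\<close>

text \<open>Well defined on positive elements only; elsewhere the description is empty.\<close>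

definition ext_nonneg where
  "ext_nonneg x = (THE s. \<exists>xs. set xs \<subseteq> carrier (mv_Gamma G) \<and> x = dom.lprod xs \<and>
     s = cod.lprod (map f xs))"

lemma ext_nonneg_lprod:
  assumes "set xs \<subseteq> carrier (mv_Gamma G)"
  shows "ext_nonneg (dom.lprod xs) = cod.lprod (map f xs)"
  unfolding ext_nonneg_def
proof (rule the_equality)
  show "\<exists>ys. set ys \<subseteq> carrier (mv_Gamma G) \<and> dom.lprod xs = dom.lprod ys \<and>
      cod.lprod (map f xs) = cod.lprod (map f ys)"
    using assms by blast
next
  fix s assume "\<exists>ys. set ys \<subseteq> carrier (mv_Gamma G) \<and> dom.lprod xs = dom.lprod ys \<and>
      s = cod.lprod (map f ys)"
  then obtain ys where "set ys \<subseteq> carrier (mv_Gamma G)" "dom.lprod xs = dom.lprod ys"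
    and s: "s = cod.lprod (map f ys)"
    by (elim exE conjE)
  then show "s = cod.lprod (map f xs)"
    unfolding s using assms by (intro lprod_map_f_unique) simp_all
qed

lemma ext_nonneg_closed [simp]:
  assumes "x \<in> carrier G" "\<one> \<preceq> x"
  shows "ext_nonneg x \<in> carrier H"
  using dom.nonneg_eq_lprod[OF assms] ext_nonneg_lprod by auto

lemma ext_nonneg_f:
  assumes "x \<in> carrier (mv_Gamma G)"
  shows "ext_nonneg x = f x"
  using ext_nonneg_lprod[of "[x]"] assms f_closed[of x]
  by (simp add: dom.carrier_mv_Gamma cod.carrier_mv_Gamma)

lemma ext_nonneg_mult:
  assumes "x \<in> carrier G" "\<one> \<preceq> x" "y \<in> carrier G" "\<one> \<preceq> y"
  shows "ext_nonneg (x \<otimes> y) = ext_nonneg x \<otimes>\<^bsub>H\<^esub> ext_nonneg y"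
proof -
  obtain xs ys where s: "set xs \<subseteq> carrier (mv_Gamma G)" "x = dom.lprod xs"
    "set ys \<subseteq> carrier (mv_Gamma G)" "y = dom.lprod ys"
    using dom.nonneg_eq_lprod assms by metis
  have "x \<otimes> y = dom.lprod (xs @ ys)"
    using s dom.Gamma_subset by (simp only: dom.lprod_append)
  moreover have "cod.lprod (map f (xs @ ys)) = cod.lprod (map f xs) \<otimes>\<^bsub>H\<^esub> cod.lprod (map f ys)"
    unfolding map_append using s(1,3) by (intro cod.lprod_append cod.Gamma_subset map_f_closed)
  ultimately show ?thesis
    using s ext_nonneg_lprod[of xs] ext_nonneg_lprod[of ys] ext_nonneg_lprod[of "xs @ ys"] by simp
qed

text \<open>Summands of \<open>p\<close> lie below \<open>p\<close> and summands of \<open>q\<close>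
  below \<open>q\<close>, so they are pairwise disjoint. This passes through \<open>f\<close> inside
  the unit interval and then back to the sums of the images.\<close>

lemma ext_nonneg_disjoint:
  assumes "p \<bottom> q" "p \<in> carrier G" "q \<in> carrier G"
  shows "ext_nonneg p \<bottom>\<^bsub>H\<^esub> ext_nonneg q"
proof -
  note pq = dom.disjoint_nonneg[OF assms]
  obtain xs ys where s: "set xs \<subseteq> carrier (mv_Gamma G)" "p = dom.lprod xs"
    "set ys \<subseteq> carrier (mv_Gamma G)" "q = dom.lprod ys"
    using dom.nonneg_eq_lprod assms pq by metis
  have "x \<bottom> y" if "x \<in> set xs" "y \<in> set ys" for x y
  proof -
    have xy: "x \<in> carrier G" "\<one> \<preceq> x" "y \<in> carrier G" "\<one> \<preceq> y"
      using s that by (auto simp: dom.carrier_mv_Gamma)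
    have le: "x \<preceq> p" "y \<preceq> q"
      using s that dom.lprod_ge[OF dom.Gamma_subset dom.Gamma_nonneg] by auto
    have m: "x \<triangle> y \<preceq> x" "x \<triangle> y \<preceq> y" "x \<triangle> y \<in> carrier G"
      using xy by (auto simp: dom.mt_left dom.mt_right)
    have "x \<triangle> y \<preceq> p \<triangle> q"
      using dom.ord_trans[OF m(1) le(1)] dom.ord_trans[OF m(2) le(2)] m(3) xy assms
      by (intro dom.mt_greatest) auto
    then show ?thesis using xy assms m by (intro dom.ord_antisym dom.mt_greatest) auto
  qed
  then have "\<forall>x\<in>set (map f xs). \<forall>y\<in>set (map f ys). x \<bottom>\<^bsub>H\<^esub> y"
    using s(1,3) by (auto intro!: f_disjoint)
  then show ?thesis
    using s ext_nonneg_lprod map_f_closed cod.Gamma_subset cod.Gamma_nonneg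
    by (metis cod.disjoint_lprods)
qed

section \<open>Extension to the whole group\<close>

definition ext where
  "ext x = ext_nonneg (x \<nabla> \<one>) \<otimes>\<^bsub>H\<^esub> inv\<^bsub>H\<^esub> ext_nonneg ((x \<nabla> \<one>) \<otimes> inv x)"

text \<open>\<open>ext\<close> is defined through the canonical decomposition into positive and
  negative part. Any other difference of positive elements gives the same value: equal differences
  \<open>P - N\<close> and \<open>p - q\<close> mean equal sums \<open>P + q\<close> and
  \<open>p + N\<close>, on which \<open>ext_nonneg\<close> is additive.\<close>

lemma ext_mult_inv:
  assumes "p \<in> carrier G" "\<one> \<preceq> p" "q \<in> carrier G" "\<one> \<preceq> q"
  shows "ext (p \<otimes> inv q) = ext_nonneg p \<otimes>\<^bsub>H\<^esub> inv\<^bsub>H\<^esub> ext_nonneg q"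
proof -
  define x where "x = p \<otimes> inv q"
  define P where "P = x \<nabla> \<one>"
  define N where "N = P \<otimes> inv x"
  have x: "x \<in> carrier G" using assms by (simp add: x_def)
  then have PN: "P \<in> carrier G" "\<one> \<preceq> P" "N \<in> carrier G" "\<one> \<preceq> N"
    by (auto simp: P_def N_def dom.jn_left dom.jn_right dom.le_mult_inv_iff)
  have "P \<otimes> q = p \<otimes> N"
  proof -
    have "x \<otimes> N = P" using x PN(1) by (simp add: N_def dom.m_comm[of x])
    moreover have "p = x \<otimes> q" using assms by (simp add: x_def)
    moreover have "(x \<otimes> q) \<otimes> N = (x \<otimes> N) \<otimes> q"
      using x assms(3) PN(3) by (simp add: dom.m_ac)
    ultimately show ?thesis by simp
  qed
  then have "ext_nonneg P \<otimes>\<^bsub>H\<^esub> ext_nonneg q = ext_nonneg p \<otimes>\<^bsub>H\<^esub> ext_nonneg N"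
    using ext_nonneg_mult[OF PN(1,2) assms(3,4)] ext_nonneg_mult[OF assms(1,2) PN(3,4)] by simp
  then have "ext_nonneg P \<otimes>\<^bsub>H\<^esub> inv\<^bsub>H\<^esub> ext_nonneg N = ext_nonneg p \<otimes>\<^bsub>H\<^esub> inv\<^bsub>H\<^esub> ext_nonneg q"
    using assms PN by (intro cod.mult_inv_eqI) auto
  then show ?thesis
    unfolding ext_def x_def[symmetric] P_def[symmetric] N_def[symmetric] .
qed

lemma ext_f:
  assumes "x \<in> carrier (mv_Gamma G)"
  shows "ext x = f x"
  using ext_mult_inv[of x \<one>] assms f_closed[of x] ext_nonneg_f[OF assms]
    ext_nonneg_f[OF dom.one_in_Gamma] f_one
  by (simp add: dom.carrier_mv_Gamma cod.carrier_mv_Gamma)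

lemma ext_closed [simp]: "x \<in> carrier G \<Longrightarrow> ext x \<in> carrier H"
  by (simp add: ext_def dom.jn_left dom.jn_right dom.le_mult_inv_iff)

lemma ext_mult:
  assumes "x \<in> carrier G" "y \<in> carrier G"
  shows "ext (x \<otimes> y) = ext x \<otimes>\<^bsub>H\<^esub> ext y"
proof -
  obtain p q where pq: "p \<in> carrier G" "q \<in> carrier G" "p \<bottom> q" "x = p \<otimes> inv q"
    using dom.pos_neg_parts[OF assms(1)] .
  obtain r s where rs: "r \<in> carrier G" "s \<in> carrier G" "r \<bottom> s" "y = r \<otimes> inv s"
    using dom.pos_neg_parts[OF assms(2)] .
  note pos = dom.disjoint_nonneg[OF pq(3,1,2)] dom.disjoint_nonneg[OF rs(3,1,2)]
  have "x \<otimes> y = (p \<otimes> r) \<otimes> inv (q \<otimes> s)"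
    unfolding pq(4) rs(4) using pq(1,2) rs(1,2) by (rule dom.mult_inv_mult)
  then show ?thesis
    using pq rs pos by (simp add: ext_mult_inv ext_nonneg_mult dom.mult_nonneg cod.mult_inv_mult)
qed

lemma ext_one: "ext \<one> = \<one>\<^bsub>H\<^esub>"
  using ext_f[OF dom.one_in_Gamma] f_one by simp

lemma ext_inv: "x \<in> carrier G \<Longrightarrow> ext (inv x) = inv\<^bsub>H\<^esub> ext x"
  using ext_mult[of "inv x" x] ext_one by (simp add: cod.inv_equality)

text \<open>Write \<open>x\<close> as a difference of disjoint \<open>p\<close> and
  \<open>q\<close>. Their images are disjoint again, so uniqueness of the positive part identifies
  the image of \<open>p\<close> as the positive part of \<open>ext x\<close>.\<close>

lemma ext_pos_part:
  assumes "x \<in> carrier G"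
  shows "ext (x \<nabla> \<one>) = ext x \<nabla>\<^bsub>H\<^esub> \<one>\<^bsub>H\<^esub>"
proof -
  obtain p q where pq: "p \<in> carrier G" "q \<in> carrier G" "p \<bottom> q" "x = p \<otimes> inv q"
    using dom.pos_neg_parts[OF assms] .
  note pos = dom.disjoint_nonneg[OF pq(3,1,2)]
  have "ext (x \<nabla> \<one>) = ext_nonneg p"
    using ext_mult_inv[of p \<one>] pq pos ext_nonneg_f[OF dom.one_in_Gamma] f_one
    by (simp add: dom.pos_part_unique)
  also have "\<dots> = ext x \<nabla>\<^bsub>H\<^esub> \<one>\<^bsub>H\<^esub>"
    using cod.pos_part_unique[OF ext_nonneg_disjoint[OF pq(3,1,2)]] pq pos
    by (simp add: ext_mult_inv)
  finally show ?thesis .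
qed

text \<open>A join is a translated positive part, by \<open>jn_eq_pos_part\<close>; additivity and
  \<open>ext_pos_part\<close> therefore suffice.\<close>

lemma ext_join:
  assumes "x \<in> carrier G" "y \<in> carrier G"
  shows "ext (x \<nabla> y) = ext x \<nabla>\<^bsub>H\<^esub> ext y"
  using assms by (simp add: dom.jn_eq_pos_part[of x y] cod.jn_eq_pos_part[of "ext x" "ext y"]
      ext_mult ext_inv ext_pos_part del: dom.inv_cancel cod.inv_cancel)

lemma ext_meet:
  assumes "x \<in> carrier G" "y \<in> carrier G"
  shows "ext (x \<triangle> y) = ext x \<triangle>\<^bsub>H\<^esub> ext y"
  using assms by (simp add: dom.mt_jn_mult cod.mt_jn_mult ext_mult ext_inv ext_join)

lemma ext_ulg_hom: "ext \<in> ulg_hom G H"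
  unfolding ulg_hom_def hom_def using ext_f[OF dom.unit_in_Gamma] f_unit
  by (auto simp: ext_mult ext_join ext_meet)

text \<open>A positive element of \<open>H\<close> is a sum of elements of the unit interval, each
  of which has a preimage under \<open>f\<close>; the other elements are differences of positive
  ones.\<close>

lemma ext_surj:
  assumes "f ` carrier (mv_Gamma G) = carrier (mv_Gamma H)"
  shows "ext ` carrier G = carrier H"
proof
  have *: "\<exists>p\<in>carrier G. \<one> \<preceq> p \<and> ext_nonneg p = y" if "y \<in> carrier H" "\<one>\<^bsub>H\<^esub> \<preceq>\<^bsub>H\<^esub> y" for y
  proof -
    obtain ys where ys: "set ys \<subseteq> carrier (mv_Gamma H)" "y = cod.lprod ys"
      using cod.nonneg_eq_lprod \<open>y \<in> carrier H\<close> \<open>\<one>\<^bsub>H\<^esub> \<preceq>\<^bsub>H\<^esub> y\<close> by blast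
    then have "ys \<in> lists (f ` carrier (mv_Gamma G))" using assms by auto
    then obtain xs where "set xs \<subseteq> carrier (mv_Gamma G)" "map f xs = ys"
      by (auto simp: lists_image)
    then show ?thesis
      using ys ext_nonneg_lprod[of xs] dom.Gamma_subset[of xs] dom.Gamma_nonneg[of xs] dom.lprod_nonneg[of xs]
      by (intro bexI[of _ "dom.lprod xs"]) auto
  qed
  show "carrier H \<subseteq> ext ` carrier G"
  proof
    fix y assume "y \<in> carrier H"
    then obtain p q where pq: "p \<in> carrier H" "q \<in> carrier H" "p \<bottom>\<^bsub>H\<^esub> q" "y = p \<otimes>\<^bsub>H\<^esub> inv\<^bsub>H\<^esub> q"
      by (rule cod.pos_neg_parts)
    obtain p' q' where "p' \<in> carrier G" "\<one> \<preceq> p'" "ext_nonneg p' = p"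
      "q' \<in> carrier G" "\<one> \<preceq> q'" "ext_nonneg q' = q"
      using *[of p] *[of q] pq cod.disjoint_nonneg[OF pq(3,1,2)] by blast
    then show "y \<in> ext ` carrier G"
      using pq ext_mult_inv[of p' q'] by (intro image_eqI[of _ _ "p' \<otimes> inv q'"]) simp_all
  qed
qed auto

end

section \<open>The group of McNaughton functions\<close>

definition int_affine :: "nat \<Rightarrow> ((nat \<Rightarrow> real) \<Rightarrow> real) set" where
  "int_affine N = {\<phi>. \<exists>(a :: nat \<Rightarrow> int) (b :: int).
     \<phi> = (\<lambda>x. of_int b + (\<Sum>i<N. of_int (a i) * x i))}"

lemma int_affineI:
  "(\<And>x. \<phi> x = of_int b + (\<Sum>i<N. of_int (a i) * x i)) \<Longrightarrow> \<phi> \<in> int_affine N"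
  unfolding int_affine_def by (auto intro!: exI[of _ a] exI[of _ b])

lemma int_affine_const: "(\<lambda>x. of_int b) \<in> int_affine N"
  by (rule int_affineI[of _ b "\<lambda>_. 0"]) simp

lemma int_affine_coord: "k < N \<Longrightarrow> (\<lambda>x. x k) \<in> int_affine N"
  by (rule int_affineI[of _ 0 "\<lambda>i. if i = k then 1 else 0"]) (simp add: if_distrib if_distribR cong: if_cong)

lemma int_affine_add:
  assumes "\<phi> \<in> int_affine N" "\<psi> \<in> int_affine N"
  shows "(\<lambda>x. \<phi> x + \<psi> x) \<in> int_affine N"
proof -
  obtain a b where 1: "\<phi> = (\<lambda>x. of_int b + (\<Sum>i<N. of_int (a i) * x i))"
    using assms(1) by (auto simp: int_affine_def)
  obtain c d where 2: "\<psi> = (\<lambda>x. of_int d + (\<Sum>i<N. of_int (c i) * x i))"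
    using assms(2) by (auto simp: int_affine_def)
  show ?thesis
    by (rule int_affineI[of _ "b + d" "\<lambda>i. a i + c i"]) (simp add: 1 2 sum.distrib distrib_right)
qed

lemma int_affine_mult:
  assumes "\<phi> \<in> int_affine N"
  shows "(\<lambda>x. of_int c * \<phi> x) \<in> int_affine N"
proof -
  obtain a b where 1: "\<phi> = (\<lambda>x. of_int b + (\<Sum>i<N. of_int (a i) * x i))"
    using assms(1) by (auto simp: int_affine_def)
  show ?thesis
    by (rule int_affineI[of _ "c * b" "\<lambda>i. c * a i"]) (simp add: 1 sum_distrib_left algebra_simps)
qed

lemma int_affine_diff:
  assumes "\<phi> \<in> int_affine N" "\<psi> \<in> int_affine N"
  shows "(\<lambda>x. \<phi> x - \<psi> x) \<in> int_affine N"
  using int_affine_add[OF assms(1) int_affine_mult[OF assms(2), of "-1"]] by simp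

lemma int_affine_sum:
  "(\<And>i. i < (n::nat) \<Longrightarrow> \<phi> i \<in> int_affine N) \<Longrightarrow> (\<lambda>x. \<Sum>i<n. \<phi> i x) \<in> int_affine N"
proof (induction n)
  case 0
  then show ?case using int_affine_const[of 0] by simp
next
  case (Suc n)
  then show ?case using int_affine_add[of "\<lambda>x. \<Sum>i<n. \<phi> i x" N "\<phi> n"] by simp
qed

lemma int_affine_substitute:
  assumes "\<phi> \<in> int_affine N" "\<And>i. i < N \<Longrightarrow> (\<lambda>x. s x i) \<in> int_affine N'"
  shows "(\<lambda>x. \<phi> (s x)) \<in> int_affine N'"
proof -
  obtain a b where "\<phi> = (\<lambda>x. of_int b + (\<Sum>i<N. of_int (a i) * x i))"
    using assms(1) by (auto simp: int_affine_def)
  then show ?thesis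
    using assms(2) by (auto intro!: int_affine_add int_affine_const int_affine_sum int_affine_mult)
qed

lemma int_affine_mono: "\<lbrakk>\<phi> \<in> int_affine N; N \<le> N'\<rbrakk> \<Longrightarrow> \<phi> \<in> int_affine N'"
  using int_affine_substitute[of \<phi> N "\<lambda>x. x" N'] by (simp add: int_affine_coord)

lemma int_affine_bounded:
  assumes "\<phi> \<in> int_affine N"
  shows "\<exists>K::nat. \<forall>x\<in>cube UNIV. \<phi> x \<le> real K"
proof -
  obtain a b where \<phi>: "\<phi> = (\<lambda>x. of_int b + (\<Sum>i<N. of_int (a i) * x i))"
    using assms(1) by (auto simp: int_affine_def)
  \<comment> \<open>Coordinates lie in \<open>{0..1}\<close>, so each term is at most the absolute
    value of its coefficient.\<close>
  have "\<phi> x \<le> real (nat (\<bar>b\<bar> + (\<Sum>i<N. \<bar>a i\<bar>)))" if "x \<in> cube UNIV" for x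
  proof -
    have "of_int (a i) * x i \<le> \<bar>of_int (a i)\<bar>" for i
    proof -
      have "0 \<le> x i" "x i \<le> 1" using that by (auto simp: cube_def PiE_iff)
      then have "\<bar>of_int (a i) * x i\<bar> \<le> \<bar>of_int (a i)\<bar>"
        by (simp add: abs_mult mult_left_le)
      then show ?thesis by linarith
    qed
    then have "\<phi> x \<le> of_int \<bar>b\<bar> + (\<Sum>i<N. \<bar>of_int (a i)\<bar>)"
      unfolding \<phi> by (intro add_mono sum_mono) auto
    also have "\<dots> = real (nat (\<bar>b\<bar> + (\<Sum>i<N. \<bar>a i\<bar>)))"
      by (simp add: sum_nonneg)
    finally show ?thesis .
  qed
  then show ?thesis by blast
qed

section \<open>Piecewise affine functions on the infinite cube\<close>

text \<open>
  Dependence on the first \<open>N\<close> coordinates is stated separately: the affine piece may be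
  chosen according to all coordinates of \<open>x\<close>.
\<close>

definition pw_affine :: "nat \<Rightarrow> ((nat \<Rightarrow> real) \<Rightarrow> real) \<Rightarrow> bool" where
  "pw_affine N g \<longleftrightarrow> g \<in> extensional (cube UNIV) \<and> continuous_on (cube UNIV) g \<and>
     (\<forall>x\<in>cube UNIV. \<forall>y\<in>cube UNIV. (\<forall>i<N. x i = y i) \<longrightarrow> g x = g y) \<and>
     (\<exists>F. finite F \<and> F \<subseteq> int_affine N \<and> (\<forall>x\<in>cube UNIV. \<exists>\<phi>\<in>F. g x = \<phi> x))"

lemma pw_affine_extensional: "pw_affine N g \<Longrightarrow> g \<in> extensional (cube UNIV)"
  and pw_affine_continuous: "pw_affine N g \<Longrightarrow> continuous_on (cube UNIV) g"
  and pw_affine_cong: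
    "\<lbrakk>pw_affine N g; x \<in> cube UNIV; y \<in> cube UNIV; \<forall>i<N. x i = y i\<rbrakk> \<Longrightarrow> g x = g y"
  unfolding pw_affine_def by blast+

lemma pw_affine_restrictI:
  assumes "continuous_on (cube UNIV) g"
    and "\<And>x y. \<lbrakk>x \<in> cube UNIV; y \<in> cube UNIV; \<forall>i<N. x i = y i\<rbrakk> \<Longrightarrow> g x = g y"
    and "finite F" "F \<subseteq> int_affine N" "\<And>x. x \<in> cube UNIV \<Longrightarrow> \<exists>\<phi>\<in>F. g x = \<phi> x"
  shows "pw_affine N (restrict g (cube UNIV))"
  unfolding pw_affine_def
proof (intro conjI exI ballI impI)
  show "continuous_on (cube UNIV) (restrict g (cube UNIV))"
    using assms(1) by (rule continuous_on_eq) simp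
  show "finite F" "F \<subseteq> int_affine N" by fact+
next
  fix x y :: "nat \<Rightarrow> real" assume xy: "x \<in> cube UNIV" "y \<in> cube UNIV" "\<forall>i<N. x i = y i"
  then have "g x = g y" by (rule assms(2))
  with xy show "restrict g (cube UNIV) x = restrict g (cube UNIV) y" by simp
next
  fix x :: "nat \<Rightarrow> real" assume "x \<in> cube UNIV"
  then show "\<exists>\<phi>\<in>F. restrict g (cube UNIV) x = \<phi> x" using assms(5)[of x] by simp
qed simp

lemma pw_affine_mono:
  assumes "pw_affine N g" "N \<le> N'"
  shows "pw_affine N' g"
proof -
  obtain F where "finite F" "F \<subseteq> int_affine N" "\<forall>x\<in>cube UNIV. \<exists>\<phi>\<in>F. g x = \<phi> x"
    using assms(1) unfolding pw_affine_def by blast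
  moreover from this have "F \<subseteq> int_affine N'" using int_affine_mono assms(2) by blast
  moreover have "\<forall>i<N'. x i = y i \<Longrightarrow> \<forall>i<N. x i = y i" for x y :: "nat \<Rightarrow> real"
    using assms(2) by simp
  ultimately show ?thesis using assms(1) unfolding pw_affine_def by blast
qed

text \<open>\<open>C\<close> lists the affine candidates for \<open>c\<close> applied to two pieces:
  one polynomial for a sum or difference, the two given ones for a maximum or minimum. Collecting
  candidates over all pairs of pieces keeps the set finite.\<close>

lemma pw_affine_combine:
  assumes f: "pw_affine N f" and g: "pw_affine N g"
    and cont: "continuous_on (cube UNIV) (\<lambda>x. c (f x) (g x))"
    and C: "\<And>\<phi> \<psi>. \<lbrakk>\<phi> \<in> int_affine N; \<psi> \<in> int_affine N\<rbrakk> \<Longrightarrow> finite (C \<phi> \<psi>) \<and> C \<phi> \<psi> \<subseteq> int_affine N"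
    and c: "\<And>\<phi> \<psi> x. \<exists>\<theta>\<in>C \<phi> \<psi>. c (\<phi> x) (\<psi> x) = \<theta> x"
  shows "pw_affine N (\<lambda>x\<in>cube UNIV. c (f x) (g x))"
proof -
  obtain F where F: "finite F" "F \<subseteq> int_affine N" "\<And>x. x \<in> cube UNIV \<Longrightarrow> \<exists>\<phi>\<in>F. f x = \<phi> x"
    using f unfolding pw_affine_def by blast
  obtain E where E: "finite E" "E \<subseteq> int_affine N" "\<And>x. x \<in> cube UNIV \<Longrightarrow> \<exists>\<phi>\<in>E. g x = \<phi> x"
    using g unfolding pw_affine_def by blast
  let ?D = "\<Union>\<phi>\<in>F. \<Union>\<psi>\<in>E. C \<phi> \<psi>"
  have "finite ?D" "?D \<subseteq> int_affine N" using F E C by blast+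
  moreover have "\<exists>\<theta>\<in>?D. c (f x) (g x) = \<theta> x" if x: "x \<in> cube UNIV" for x
  proof -
    obtain \<phi> \<psi> where "\<phi> \<in> F" "f x = \<phi> x" "\<psi> \<in> E" "g x = \<psi> x"
      using F(3)[OF x] E(3)[OF x] by blast
    then show ?thesis using c[of \<phi> \<psi> x] by auto
  qed
  moreover have "c (f x) (g x) = c (f y) (g y)"
    if "x \<in> cube UNIV" "y \<in> cube UNIV" "\<forall>i<N. x i = y i" for x y
    using pw_affine_cong[OF f that] pw_affine_cong[OF g that] by simp
  ultimately show ?thesis
    using cont by (intro pw_affine_restrictI[where F = ?D])
qed

section \<open>The unital lattice-ordered group of piecewise affine functions\<close>

definition mcn_group :: "((nat \<Rightarrow> real) \<Rightarrow> real) ulgroup" where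
  "mcn_group = \<lparr>carrier = {g. \<exists>N. pw_affine N g},
     monoid.mult = (\<lambda>f g. \<lambda>x\<in>cube UNIV. f x + g x),
     monoid.one = (\<lambda>x\<in>cube UNIV. 0),
     lg_le = (\<lambda>f g. \<forall>x\<in>cube UNIV. f x \<le> g x),
     lg_unit = (\<lambda>x\<in>cube UNIV. 1)\<rparr>"

lemma mcn_group_carrier_iff: "g \<in> carrier mcn_group \<longleftrightarrow> (\<exists>N. pw_affine N g)"
  and mcn_group_mult: "f \<otimes>\<^bsub>mcn_group\<^esub> g = (\<lambda>x\<in>cube UNIV. f x + g x)"
  and mcn_group_one: "\<one>\<^bsub>mcn_group\<^esub> = (\<lambda>x\<in>cube UNIV. 0)"
  and mcn_group_le: "f \<preceq>\<^bsub>mcn_group\<^esub> g \<longleftrightarrow> (\<forall>x\<in>cube UNIV. f x \<le> g x)"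
  and mcn_group_unit: "\<upsilon>\<^bsub>mcn_group\<^esub> = (\<lambda>x\<in>cube UNIV. 1)"
  by (simp_all add: mcn_group_def)

lemmas mcn_group_simps =
  mcn_group_mult mcn_group_one mcn_group_le mcn_group_unit

lemma mcn_group_ext:
  assumes "f \<in> carrier mcn_group" "g \<in> carrier mcn_group" "\<And>x. x \<in> cube UNIV \<Longrightarrow> f x = g x"
  shows "f = g"
  using assms by (intro extensionalityI[of f "cube UNIV" g]) (auto simp: mcn_group_carrier_iff pw_affine_extensional)

lemma mcn_group_combine:
  assumes fg: "f \<in> carrier mcn_group" "g \<in> carrier mcn_group"
    and cont: "\<And>f g. \<lbrakk>continuous_on (cube UNIV) f; continuous_on (cube UNIV) g\<rbrakk>
      \<Longrightarrow> continuous_on (cube UNIV) (\<lambda>x. c (f x) (g x))"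
    and C: "\<And>N \<phi> \<psi>. \<lbrakk>\<phi> \<in> int_affine N; \<psi> \<in> int_affine N\<rbrakk>
      \<Longrightarrow> finite (C \<phi> \<psi>) \<and> C \<phi> \<psi> \<subseteq> int_affine N"
    and c: "\<And>\<phi> \<psi> x. \<exists>\<theta>\<in>C \<phi> \<psi>. c (\<phi> x) (\<psi> x) = \<theta> x"
  shows "(\<lambda>x\<in>cube UNIV. c (f x) (g x)) \<in> carrier mcn_group"
proof -
  obtain m n where "pw_affine m f" "pw_affine n g" using fg by (auto simp: mcn_group_carrier_iff)
  then have fg': "pw_affine (max m n) f" "pw_affine (max m n) g"
    by (auto elim!: pw_affine_mono)
  then have "continuous_on (cube UNIV) (\<lambda>x. c (f x) (g x))"
    by (intro cont pw_affine_continuous)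
  then have "pw_affine (max m n) (\<lambda>x\<in>cube UNIV. c (f x) (g x))"
    using fg' C c by (intro pw_affine_combine[where C = C])
  then show ?thesis by (auto simp: mcn_group_carrier_iff)
qed

lemma mcn_group_add:
  "\<lbrakk>f \<in> carrier mcn_group; g \<in> carrier mcn_group\<rbrakk>
    \<Longrightarrow> (\<lambda>x\<in>cube UNIV. f x + g x) \<in> carrier mcn_group"
  by (rule mcn_group_combine[where c = "(+)" and C = "\<lambda>\<phi> \<psi>. {\<lambda>x. \<phi> x + \<psi> x}"])
    (auto intro: continuous_intros int_affine_add)

lemma mcn_group_diff:
  "\<lbrakk>f \<in> carrier mcn_group; g \<in> carrier mcn_group\<rbrakk>
    \<Longrightarrow> (\<lambda>x\<in>cube UNIV. f x - g x) \<in> carrier mcn_group"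
  by (rule mcn_group_combine[where c = "(-)" and C = "\<lambda>\<phi> \<psi>. {\<lambda>x. \<phi> x - \<psi> x}"])
    (auto intro: continuous_intros int_affine_diff)

lemma mcn_group_max:
  "\<lbrakk>f \<in> carrier mcn_group; g \<in> carrier mcn_group\<rbrakk>
    \<Longrightarrow> (\<lambda>x\<in>cube UNIV. max (f x) (g x)) \<in> carrier mcn_group"
  by (rule mcn_group_combine[where c = max and C = "\<lambda>\<phi> \<psi>. {\<phi>, \<psi>}"])
    (assumption | rule continuous_on_max | auto simp: max_def)+

lemma mcn_group_min:
  "\<lbrakk>f \<in> carrier mcn_group; g \<in> carrier mcn_group\<rbrakk>
    \<Longrightarrow> (\<lambda>x\<in>cube UNIV. min (f x) (g x)) \<in> carrier mcn_group"
  by (rule mcn_group_combine[where c = min and C = "\<lambda>\<phi> \<psi>. {\<phi>, \<psi>}"])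
    (assumption | rule continuous_on_min | auto simp: min_def)+

lemma mcn_group_const: "(\<lambda>x\<in>cube UNIV. of_int b) \<in> carrier mcn_group"
proof -
  have "pw_affine 0 (\<lambda>x\<in>cube UNIV. of_int b)"
    by (rule pw_affine_restrictI[where F = "{\<lambda>x. of_int b}"]) (auto intro: int_affine_const)
  then show ?thesis by (auto simp: mcn_group_carrier_iff)
qed

lemma mcn_group_coord: "(\<lambda>x\<in>cube UNIV. x k) \<in> carrier mcn_group"
proof -
  have "pw_affine (Suc k) (\<lambda>x\<in>cube UNIV. x k)"
    by (rule pw_affine_restrictI[where F = "{\<lambda>x. x k}"])
      (auto intro: int_affine_coord continuous_on_subset[OF continuous_on_product_coordinates])
  then show ?thesis by (auto simp: mcn_group_carrier_iff)
qed

lemma comm_group_mcn_group: "comm_group mcn_group"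
proof (rule comm_groupI)
  fix x y assume xy: "x \<in> carrier mcn_group" "y \<in> carrier mcn_group"
  then show "x \<otimes>\<^bsub>mcn_group\<^esub> y \<in> carrier mcn_group"
    by (simp add: mcn_group_simps mcn_group_add)
  show "x \<otimes>\<^bsub>mcn_group\<^esub> y = y \<otimes>\<^bsub>mcn_group\<^esub> x"
    by (simp add: mcn_group_simps add.commute)
  show "\<one>\<^bsub>mcn_group\<^esub> \<otimes>\<^bsub>mcn_group\<^esub> x = x"
    using xy mcn_group_add[OF mcn_group_const[of 0] xy(1)]
    by (intro mcn_group_ext) (auto simp: mcn_group_simps cong: restrict_cong)
  have "(\<lambda>z\<in>cube UNIV. (\<lambda>z\<in>cube UNIV. 0) z - x z) \<in> carrier mcn_group"
    using mcn_group_diff[OF mcn_group_const[of 0] xy(1)] by simp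
  then show "\<exists>y\<in>carrier mcn_group. y \<otimes>\<^bsub>mcn_group\<^esub> x = \<one>\<^bsub>mcn_group\<^esub>"
    by (rule bexI[rotated]) (auto simp: mcn_group_simps)
next
  show "\<one>\<^bsub>mcn_group\<^esub> \<in> carrier mcn_group"
    using mcn_group_const[of 0] by (simp add: mcn_group_simps)
qed (auto simp: mcn_group_simps)

lemma mcn_group_bounded:
  assumes "g \<in> carrier mcn_group"
  shows "\<exists>K::nat. \<forall>x\<in>cube UNIV. g x \<le> real K"
proof -
  obtain N F where F: "finite F" "F \<subseteq> int_affine N" "\<forall>x\<in>cube UNIV. \<exists>\<phi>\<in>F. g x = \<phi> x"
    using assms unfolding mcn_group_carrier_iff pw_affine_def by blast
  have "\<forall>\<phi>\<in>F. \<exists>K::nat. \<forall>x\<in>cube UNIV. \<phi> x \<le> real K"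
    using F(2) int_affine_bounded by blast
  then obtain K :: "_ \<Rightarrow> nat" where K: "\<forall>\<phi>\<in>F. \<forall>x\<in>cube UNIV. \<phi> x \<le> real (K \<phi>)"
    by metis
  \<comment> \<open>Summing the natural-number bounds over \<open>F\<close> gives one bound that
    dominates each of them.\<close>
  have "g x \<le> real (\<Sum>\<phi>\<in>F. K \<phi>)" if x: "x \<in> cube UNIV" for x
  proof -
    obtain \<phi> where \<phi>: "\<phi> \<in> F" "g x = \<phi> x" using F(3) x by blast
    then have "g x \<le> real (K \<phi>)" using K x by simp
    also have "K \<phi> \<le> (\<Sum>\<phi>\<in>F. K \<phi>)" using F(1) \<phi>(1) by (simp add: member_le_sum)
    finally show ?thesis by simp
  qed
  then show ?thesis by blast
qed

lemma mcn_group_unit_pow: "\<upsilon>\<^bsub>mcn_group\<^esub> [^]\<^bsub>mcn_group\<^esub> (n::nat) = (\<lambda>x\<in>cube UNIV. real n)"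
  by (induction n) (auto simp: mcn_group_simps nat_pow_def cong: restrict_cong)

lemma lattice_mcn_group: "lattice (lg_order mcn_group)"
proof (rule lattice_lg_orderI)
  fix x y assume "x \<in> carrier mcn_group" "y \<in> carrier mcn_group"
  then show "\<exists>s\<in>carrier mcn_group. x \<preceq>\<^bsub>mcn_group\<^esub> s \<and> y \<preceq>\<^bsub>mcn_group\<^esub> s \<and>
      (\<forall>z\<in>carrier mcn_group. x \<preceq>\<^bsub>mcn_group\<^esub> z \<longrightarrow> y \<preceq>\<^bsub>mcn_group\<^esub> z \<longrightarrow> s \<preceq>\<^bsub>mcn_group\<^esub> z)"
    and "\<exists>s\<in>carrier mcn_group. s \<preceq>\<^bsub>mcn_group\<^esub> x \<and> s \<preceq>\<^bsub>mcn_group\<^esub> y \<and>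
      (\<forall>z\<in>carrier mcn_group. z \<preceq>\<^bsub>mcn_group\<^esub> x \<longrightarrow> z \<preceq>\<^bsub>mcn_group\<^esub> y \<longrightarrow> z \<preceq>\<^bsub>mcn_group\<^esub> s)"
    using bexI[OF _ mcn_group_max[of x y]] bexI[OF _ mcn_group_min[of x y]]
    by (simp_all add: mcn_group_simps)
next
  fix x y assume "x \<in> carrier mcn_group" "y \<in> carrier mcn_group"
    "x \<preceq>\<^bsub>mcn_group\<^esub> y" "y \<preceq>\<^bsub>mcn_group\<^esub> x"
  then show "x = y" by (intro mcn_group_ext) (auto simp: mcn_group_simps intro: antisym)
qed (auto simp: mcn_group_simps intro: order_trans)

lemma unital_l_group_mcn_group: "unital_l_group mcn_group"
proof (intro unital_l_group.intro unital_l_group_axioms.intro comm_group_mcn_group lattice_mcn_group)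
  show "\<upsilon>\<^bsub>mcn_group\<^esub> \<in> carrier mcn_group"
    using mcn_group_const[of 1] by (simp add: mcn_group_simps)
  fix x assume "x \<in> carrier mcn_group"
  then obtain K :: nat where "\<forall>z\<in>cube UNIV. x z \<le> real K" using mcn_group_bounded by blast
  then have "x \<preceq>\<^bsub>mcn_group\<^esub> \<upsilon>\<^bsub>mcn_group\<^esub> [^]\<^bsub>mcn_group\<^esub> int K"
    unfolding int_pow_int mcn_group_unit_pow by (simp add: mcn_group_le)
  then show "\<exists>n::int. x \<preceq>\<^bsub>mcn_group\<^esub> \<upsilon>\<^bsub>mcn_group\<^esub> [^]\<^bsub>mcn_group\<^esub> n" ..
qed (auto simp: mcn_group_simps)

lemma mcn_group_meet:
  assumes "f \<in> carrier mcn_group" "g \<in> carrier mcn_group"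
  shows "f \<triangle>\<^bsub>mcn_group\<^esub> g = (\<lambda>x\<in>cube UNIV. min (f x) (g x))"
proof -
  interpret unital_l_group mcn_group by (rule unital_l_group_mcn_group)
  show ?thesis
    using assms by (intro mt_eqI) (auto simp: mcn_group_le mcn_group_min)
qed

lemma mcn_group_inv:
  assumes "f \<in> carrier mcn_group"
  shows "inv\<^bsub>mcn_group\<^esub> f = (\<lambda>x\<in>cube UNIV. - f x)"
proof -
  interpret unital_l_group mcn_group by (rule unital_l_group_mcn_group)
  have "(\<lambda>x\<in>cube UNIV. - f x) \<in> carrier mcn_group"
    using mcn_group_diff[OF mcn_group_const[of 0] assms] by (simp cong: restrict_cong)
  then show ?thesis
    using assms by (intro inv_equality) (auto simp: mcn_group_simps cong: restrict_cong)
qed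

section \<open>Substitution of coordinates\<close>

definition substitute :: "(nat \<Rightarrow> nat option) \<Rightarrow> (nat \<Rightarrow> real) \<Rightarrow> nat \<Rightarrow> real" where
  "substitute e x = (\<lambda>n. case e n of None \<Rightarrow> 0 | Some k \<Rightarrow> x k)"

lemma substitute_cube: "x \<in> cube UNIV \<Longrightarrow> substitute e x \<in> cube UNIV"
  by (auto simp: substitute_def cube_def PiE_iff split: option.splits)

lemma continuous_on_substitute: "continuous_on A (substitute e)"
proof (rule continuous_on_coordinatewise_then_product)
  fix n show "continuous_on A (\<lambda>x. substitute e x n)"
    by (cases "e n")
      (auto simp: substitute_def intro: continuous_on_subset[OF continuous_on_product_coordinates])
qed

text \<open>\<open>None\<close> substitutes 0 for a coordinate and \<open>Some k\<close> the
  coordinate \<open>k\<close>. This one closure property covers the choice of indices in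
  \<open>mcn_omega\<close>, the shift, and the preimages under the shift.\<close>

lemma mcn_group_substitute:
  assumes "g \<in> carrier mcn_group"
  shows "(\<lambda>x\<in>cube UNIV. g (substitute e x)) \<in> carrier mcn_group"
proof -
  obtain N F where F: "finite F" "F \<subseteq> int_affine N" "\<forall>x\<in>cube UNIV. \<exists>\<phi>\<in>F. g x = \<phi> x"
    and dep: "\<forall>x\<in>cube UNIV. \<forall>y\<in>cube UNIV. (\<forall>i<N. x i = y i) \<longrightarrow> g x = g y"
    and cont: "continuous_on (cube UNIV) g"
    using assms unfolding mcn_group_carrier_iff pw_affine_def by blast
  \<comment> \<open>Every coordinate \<open>k\<close> substituted for one of the first
    \<open>N\<close> contributes \<open>Suc k\<close> to this sum, so it is strictly below
    \<open>N'\<close>.\<close>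
  define N' where "N' = (\<Sum>i<N. case e i of None \<Rightarrow> 0 | Some k \<Rightarrow> Suc k)"
  have N': "k < N'" if "i < N" "e i = Some k" for i k
    using that member_le_sum[of i "{..<N}" "\<lambda>i. case e i of None \<Rightarrow> 0 | Some k \<Rightarrow> Suc k"]
    by (simp add: N'_def)
  have coord: "(\<lambda>x. substitute e x i) \<in> int_affine N'" if "i < N" for i
    using that N' int_affine_const[of 0]
    by (cases "e i") (auto simp: substitute_def int_affine_coord)
  let ?F = "(\<lambda>\<phi> x. \<phi> (substitute e x)) ` F"
  have "finite ?F" using F(1) by simp
  moreover have "?F \<subseteq> int_affine N'"
  proof (rule image_subsetI)
    fix \<phi> assume "\<phi> \<in> F"
    then have "\<phi> \<in> int_affine N" using F(2) by blast
    then show "(\<lambda>x. \<phi> (substitute e x)) \<in> int_affine N'"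
      using coord by (rule int_affine_substitute)
  qed
  moreover have "\<exists>\<phi>\<in>?F. g (substitute e x) = \<phi> x" if "x \<in> cube UNIV" for x
    using F(3) substitute_cube[OF that] by auto
  moreover have "g (substitute e x) = g (substitute e y)"
    if "x \<in> cube UNIV" "y \<in> cube UNIV" "\<forall>i<N'. x i = y i" for x y
  proof -
    have "\<forall>i<N. substitute e x i = substitute e y i"
      using that N' by (auto simp: substitute_def split: option.split)
    then show ?thesis using dep that substitute_cube by blast
  qed
  moreover have "continuous_on (cube UNIV) (\<lambda>x. g (substitute e x))"
    by (rule continuous_on_compose2[OF cont continuous_on_substitute]) (auto intro: substitute_cube)
  ultimately have "pw_affine N' (\<lambda>x\<in>cube UNIV. g (substitute e x))"
    by (intro pw_affine_restrictI[where F = ?F])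
  then show ?thesis by (auto simp: mcn_group_carrier_iff)
qed

section \<open>Comparison with the McNaughton functions\<close>

lemma mcnaughton_in_mcn_group:
  assumes "mcnaughton m f"
  shows "(\<lambda>x\<in>cube UNIV. f (restrict x {..<m})) \<in> carrier mcn_group"
proof -
  obtain t :: nat and a :: "nat \<Rightarrow> nat \<Rightarrow> int" and b :: "nat \<Rightarrow> int" where
    ab: "\<forall>x\<in>cube {..<m}. \<exists>j<t. f x = of_int (b j) + (\<Sum>i<m. of_int (a j i) * x i)"
    and cont: "continuous_on (cube {..<m}) f"
    using assms unfolding mcnaughton_def by blast
  have cube: "restrict x {..<m} \<in> cube {..<m}" if "x \<in> cube UNIV" for x
    using that by (auto simp: cube_def PiE_iff)
  let ?F = "(\<lambda>j x. of_int (b j) + (\<Sum>i<m. of_int (a j i) * x i)) ` {..<t}"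
  have "finite ?F" "?F \<subseteq> int_affine m" by (auto simp: int_affine_def)
  moreover have "\<exists>\<phi>\<in>?F. f (restrict x {..<m}) = \<phi> x" if "x \<in> cube UNIV" for x
    using ab cube[OF that] by fastforce
  moreover have "f (restrict x {..<m}) = f (restrict y {..<m})" if "\<forall>i<m. x i = y i" for x y
    using that by (metis (mono_tags, lifting) lessThan_iff restrict_ext)
  moreover have "continuous_on (cube UNIV) (\<lambda>x. restrict x {..<m} :: nat \<Rightarrow> real)"
  proof (rule continuous_on_coordinatewise_then_product)
    fix n show "continuous_on (cube UNIV) (\<lambda>x. restrict x {..<m} n :: real)"
      by (cases "n < m") (auto intro: continuous_on_subset[OF continuous_on_product_coordinates])
  qed
  then have "continuous_on (cube UNIV) (\<lambda>x. f (restrict x {..<m}))"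
    by (rule continuous_on_compose2[OF cont]) (auto intro: cube)
  ultimately have "pw_affine m (\<lambda>x\<in>cube UNIV. f (restrict x {..<m}))"
    by (intro pw_affine_restrictI[where F = ?F])
  then show ?thesis by (auto simp: mcn_group_carrier_iff)
qed

lemma pw_affine_mcnaughton:
  assumes g: "pw_affine N g" and range: "\<And>x. x \<in> cube UNIV \<Longrightarrow> g x \<in> {0..1}"
  shows "mcnaughton N (\<lambda>z. g (\<lambda>n. if n < N then z n else 0))"
proof -
  obtain F where F: "finite F" "F \<subseteq> int_affine N" "\<forall>x\<in>cube UNIV. \<exists>\<phi>\<in>F. g x = \<phi> x"
    using g unfolding pw_affine_def by blast
  have cont: "continuous_on (cube UNIV) g" using g by (rule pw_affine_continuous)
  \<comment> \<open>A point of the finite cube is \<open>undefined\<close> from \<open>N\<close> on,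
    and \<open>undefined\<close> need not lie in \<open>{0..1}\<close>; padding with 0 gives a point
    of the infinite cube.\<close>
  let ?p = "\<lambda>z n. if n < N then z n else (0::real)"
  have cube: "?p z \<in> cube UNIV" if "z \<in> cube {..<N}" for z
    using that by (auto simp: cube_def PiE_iff)
  \<comment> \<open>\<open>mcnaughton\<close> wants the polynomials indexed below some
    \<open>t\<close>, so the finite set \<open>F\<close> is enumerated.\<close>
  obtain \<phi> where \<phi>: "F = \<phi> ` {..<card F}"
    using ex_bij_betw_nat_finite[OF F(1)] by (auto simp: bij_betw_def atLeast0LessThan)
  have "\<forall>j. \<exists>a b. j < card F \<longrightarrow>
      \<phi> j = (\<lambda>x. of_int b + (\<Sum>i<N. of_int (a i :: int) * x i))"
    using F(2) \<phi> unfolding int_affine_def by blast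
  then obtain a b where ab: "\<And>j. j < card F \<Longrightarrow>
      \<phi> j = (\<lambda>x. of_int (b j) + (\<Sum>i<N. of_int (a j i :: int) * x i))"
    by metis
  have "\<exists>j<card F. g (?p z) = of_int (b j) + (\<Sum>i<N. of_int (a j i) * z i)"
    if z: "z \<in> cube {..<N}" for z
  proof -
    obtain \<psi> where "\<psi> \<in> F" "g (?p z) = \<psi> (?p z)" using F(3) cube[OF z] by blast
    moreover from this have "\<psi> \<in> \<phi> ` {..<card F}" by (simp add: \<phi>[symmetric])
    ultimately obtain j where "j < card F" "g (?p z) = \<phi> j (?p z)" by auto
    then show ?thesis by (intro exI[of _ j]) (simp add: ab)
  qed
  moreover have "continuous_on (cube {..<N}) ?p"
  proof (rule continuous_on_coordinatewise_then_product)
    fix n show "continuous_on (cube {..<N}) (\<lambda>z. ?p z n)"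
      by (cases "n < N") (auto intro: continuous_on_subset[OF continuous_on_product_coordinates])
  qed
  then have "continuous_on (cube {..<N}) (\<lambda>z. g (?p z))"
    by (rule continuous_on_compose2[OF cont]) (auto intro: cube)
  ultimately show ?thesis
    unfolding mcnaughton_def using range cube by blast
qed

text \<open>Choosing coordinates \<open>i k\<close> for a McNaughton function is a substitution into
  a member of the group. Conversely, an element of the group depends on finitely many coordinates
  only, so zeroing the remaining ones leaves its values unchanged, and the first \<open>N\<close>
  indices can be chosen in their own order.\<close>

lemma carrier_mcn_omega:
  "carrier mcn_omega = {g \<in> carrier mcn_group. \<forall>x\<in>cube UNIV. 0 \<le> g x \<and> g x \<le> 1}"
proof (intro equalityI subsetI)
  fix g assume "g \<in> carrier mcn_omega"
  then obtain m f and i :: "nat \<Rightarrow> nat" where g: "g \<in> cube UNIV \<rightarrow>\<^sub>E {0..1}"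
    and f: "mcnaughton m f" and gf: "\<forall>x\<in>cube UNIV. g x = f (\<lambda>k\<in>{..<m}. x (i k))"
    by (auto simp: mcn_omega_def)
  \<comment> \<open>Values of \<open>e\<close> from \<open>m\<close> on do not matter, since
    \<open>restrict\<close> cuts these coordinates off.\<close>
  define e where "e k = (if k < m then Some (i k) else None)" for k
  have r: "restrict (substitute e x) {..<m} = (\<lambda>k\<in>{..<m}. x (i k))" for x
    by (auto simp: e_def substitute_def restrict_def)
  have "g = (\<lambda>x\<in>cube UNIV. (\<lambda>x\<in>cube UNIV. f (restrict x {..<m})) (substitute e x))"
  proof (rule extensionalityI[where A = "cube UNIV"])
    show "g \<in> extensional (cube UNIV)" using g by (simp add: PiE_iff)
  qed (use gf in \<open>auto simp: r substitute_cube\<close>)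
  then have "g \<in> carrier mcn_group"
    using mcn_group_substitute[OF mcnaughton_in_mcn_group[OF f], of e] by simp
  then show "g \<in> {g \<in> carrier mcn_group. \<forall>x\<in>cube UNIV. 0 \<le> g x \<and> g x \<le> 1}"
    using g by (auto simp: PiE_iff)
next
  fix g assume "g \<in> {g \<in> carrier mcn_group. \<forall>x\<in>cube UNIV. 0 \<le> g x \<and> g x \<le> 1}"
  then obtain N where g: "pw_affine N g" and range: "\<And>x. x \<in> cube UNIV \<Longrightarrow> g x \<in> {0..1}"
    by (auto simp: mcn_group_carrier_iff)
  have "g x = g (\<lambda>n. if n < N then (\<lambda>k\<in>{..<N}. x k) n else 0)" if x: "x \<in> cube UNIV" for x
  proof -
    have "(\<lambda>n. if n < N then (\<lambda>k\<in>{..<N}. x k) n else 0) \<in> cube UNIV"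
      using x by (auto simp: cube_def PiE_iff)
    then show ?thesis using x by (intro pw_affine_cong[OF g]) auto
  qed
  moreover have "strict_mono_on {..<N} (\<lambda>k::nat. k)" by (simp add: strict_mono_on_def)
  moreover have "g \<in> cube UNIV \<rightarrow>\<^sub>E {0..1}"
    using pw_affine_extensional[OF g] range by (auto simp: PiE_iff)
  ultimately show "g \<in> carrier mcn_omega"
    using pw_affine_mcnaughton[OF g range] unfolding mcn_omega_def
    by (auto intro!: exI[of _ N] exI[of _ "\<lambda>z. g (\<lambda>n. if n < N then z n else 0)"] exI[of _ "\<lambda>k. k"])
qed

text \<open>Both sides use functions that are extensional on the cube, and the unit interval of the
  group is the set of McNaughton functions itself, so the identity is the isomorphism.\<close>

lemma mv_isomorphic_Gamma_mcn_group: "mv_isomorphic (mv_Gamma mcn_group) mcn_omega"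
proof -
  interpret unital_l_group mcn_group by (rule unital_l_group_mcn_group)
  have car: "carrier (mv_Gamma mcn_group) = carrier mcn_omega"
    by (auto simp: carrier_mv_Gamma carrier_mcn_omega mcn_group_simps)
  have "id \<in> mv_hom (mv_Gamma mcn_group) mcn_omega"
    unfolding mv_hom_def
  proof (intro CollectI conjI ballI)
    fix x y assume "x \<in> carrier (mv_Gamma mcn_group)" "y \<in> carrier (mv_Gamma mcn_group)"
    then have xy: "x \<in> carrier mcn_group" "y \<in> carrier mcn_group" by (auto simp: carrier_mv_Gamma)
    then have "mv_plus (mv_Gamma mcn_group) x y = (\<lambda>z\<in>cube UNIV. min 1 (x z + y z))"
      by (simp add: mv_Gamma_def mcn_group_meet) (simp add: mcn_group_simps cong: restrict_cong)
    then show "id (mv_plus (mv_Gamma mcn_group) x y) = mv_plus mcn_omega (id x) (id y)"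
      by (simp add: mcn_omega_def)
    have "mv_neg (mv_Gamma mcn_group) x = (\<lambda>z\<in>cube UNIV. 1 - x z)"
      using xy by (simp add: mv_Gamma_def mcn_group_inv mcn_group_simps cong: restrict_cong)
    then show "id (mv_neg (mv_Gamma mcn_group) x) = mv_neg mcn_omega (id x)"
      by (simp add: mcn_omega_def)
  next
    show "id \<in> carrier (mv_Gamma mcn_group) \<rightarrow> carrier mcn_omega" by (simp add: car)
    show "id (mv_zero (mv_Gamma mcn_group)) = mv_zero mcn_omega"
      by (simp add: mv_Gamma_def mcn_omega_def mcn_group_one)
  qed
  then show ?thesis unfolding mv_isomorphic_def using car by (auto intro: bexI[of _ id])
qed

section \<open>The shift endomorphism\<close>

text \<open>Geometrically, \<open>g\<close> is restricted to the face of the cube where coordinate 0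
  vanishes, and that face is identified with the whole cube by renumbering.\<close>

definition shift :: "((nat \<Rightarrow> real) \<Rightarrow> real) \<Rightarrow> (nat \<Rightarrow> real) \<Rightarrow> real" where
  "shift g = (\<lambda>x\<in>cube UNIV. g (substitute (case_nat None Some) x))"

lemma shift_closed: "g \<in> carrier mcn_omega \<Longrightarrow> shift g \<in> carrier mcn_omega"
  by (auto simp: carrier_mcn_omega shift_def mcn_group_substitute substitute_cube)

lemma shift_mv_hom: "shift \<in> mv_hom mcn_omega mcn_omega"
  by (auto simp: mv_hom_def shift_closed)
    (auto simp: mcn_omega_def shift_def substitute_cube cong: restrict_cong)

lemma shift_surj: "shift ` carrier mcn_omega = carrier mcn_omega"
proof (intro equalityI subsetI)
  fix g assume g: "g \<in> carrier mcn_omega"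
  \<comment> \<open>Prepending 0 to a point and then dropping its first coordinate is the identity,
    so composing \<open>g\<close> with the map that drops the first coordinate gives a
    preimage.\<close>
  let ?e = "\<lambda>n. Some (Suc n)"
  have "(\<lambda>x\<in>cube UNIV. g (substitute ?e x)) \<in> carrier mcn_omega"
    using g by (auto simp: carrier_mcn_omega mcn_group_substitute substitute_cube)
  moreover from shift_closed[OF this] have "shift (\<lambda>x\<in>cube UNIV. g (substitute ?e x)) = g"
  proof (intro mcn_group_ext)
    fix x :: "nat \<Rightarrow> real" assume "x \<in> cube UNIV"
    moreover have "substitute ?e (substitute (case_nat None Some) x) = x"
      by (simp add: substitute_def)
    ultimately show "shift (\<lambda>x\<in>cube UNIV. g (substitute ?e x)) x = g x"
      by (simp add: shift_def substitute_cube)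
  qed (use g in \<open>simp_all add: carrier_mcn_omega\<close>)
  ultimately show "g \<in> shift ` carrier mcn_omega" by force
qed (auto simp: shift_closed)

lemma shift_not_inj: "\<not> inj_on shift (carrier mcn_omega)"
proof
  let ?c = "\<lambda>x\<in>cube UNIV. x 0" and ?z = "\<lambda>x\<in>cube UNIV. 0 :: real"
  assume "inj_on shift (carrier mcn_omega)"
  moreover have "?c \<in> carrier mcn_omega"
    by (auto simp: carrier_mcn_omega mcn_group_coord) (auto simp: cube_def PiE_iff)
  moreover have "?z \<in> carrier mcn_omega"
    using mcn_group_const[of 0] by (simp add: carrier_mcn_omega)
  moreover have "shift ?c = shift ?z"
    by (auto simp: shift_def substitute_cube) (auto simp: substitute_def)
  ultimately have "?c = ?z" by (simp add: inj_on_def)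
  \<comment> \<open>The all-ones point separates the coordinate function from zero.\<close>
  moreover have "(\<lambda>_. 1) \<in> cube UNIV" by (auto simp: cube_def PiE_iff)
  ultimately show False by (metis restrict_apply' zero_neq_one)
qed

section \<open>Transport to an arbitrary unital lattice-ordered group\<close>

lemma mv_hom_comp:
  "\<lbrakk>f \<in> mv_hom A B; g \<in> mv_hom B C\<rbrakk> \<Longrightarrow> (\<lambda>x. g (f x)) \<in> mv_hom A C"
  by (auto simp: mv_hom_def Pi_iff)

text \<open>Applying \<open>f\<close> to the result of an operation on preimages gives the operation
  on the given elements. To conclude that this result is the chosen preimage it must lie in
  \<open>carrier A\<close>; the record \<open>mv\<close> has no closure laws, so closure is
  assumed.\<close>

lemma mv_hom_inv_into:
  assumes f: "f \<in> mv_hom A B" "bij_betw f (carrier A) (carrier B)"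
    and A: "mv_zero A \<in> carrier A"
      "\<And>x y. \<lbrakk>x \<in> carrier A; y \<in> carrier A\<rbrakk> \<Longrightarrow> mv_plus A x y \<in> carrier A"
      "\<And>x. x \<in> carrier A \<Longrightarrow> mv_neg A x \<in> carrier A"
  shows "inv_into (carrier A) f \<in> mv_hom B A"
proof -
  let ?g = "inv_into (carrier A) f"
  have g: "?g y \<in> carrier A" "f (?g y) = y" if "y \<in> carrier B" for y
    using f(2) that by (auto simp: bij_betw_def inv_into_into f_inv_into_f)
  have gI: "?g y = x" if "x \<in> carrier A" "f x = y" for x y
    using f(2) that by (auto simp: bij_betw_def)
  show ?thesis
    using f(1) A g unfolding mv_hom_def by (auto intro!: gI)
qed

text \<open>The extension of \<open>f\<close> is onto, and it agrees with \<open>f\<close> on the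
  unit interval, so an automorphism would make \<open>f\<close> injective.\<close>

lemma not_hopfian_if_Gamma_endo:
  assumes "unital_l_group M" "f \<in> mv_hom (mv_Gamma M) (mv_Gamma M)"
    and surj: "f ` carrier (mv_Gamma M) = carrier (mv_Gamma M)"
    and not_inj: "\<not> inj_on f (carrier (mv_Gamma M))"
  shows "\<not> hopfian M"
proof -
  interpret unital_l_group M by (rule assms(1))
  interpret mv_hom_extension M M f
    using assms by (intro mv_hom_extension.intro mv_hom_extension_axioms.intro)
  have "inj_on ext (carrier M) \<Longrightarrow> inj_on f (carrier (mv_Gamma M))"
    using ext_f by (auto simp: inj_on_def carrier_mv_Gamma)
  then show ?thesis
    using not_inj ext_ulg_hom ext_surj[OF surj] by (auto simp: hopfian_def ulg_aut_def bij_betw_def)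
qed

text \<open>The first conjunct exhibits a group with the required unit interval; the second treats
  every such group over any carrier type.\<close>

theorem corollary5p5:
  shows "(\<exists>M :: ((nat \<Rightarrow> real) \<Rightarrow> real) ulgroup.
            unital_l_group M \<and> mv_isomorphic (mv_Gamma M) mcn_omega) \<and>
         (\<forall>M :: 'a ulgroup.
            unital_l_group M \<and> mv_isomorphic (mv_Gamma M) mcn_omega \<longrightarrow> \<not> hopfian M)"
proof (intro conjI allI impI)
  show "\<exists>M :: ((nat \<Rightarrow> real) \<Rightarrow> real) ulgroup.
      unital_l_group M \<and> mv_isomorphic (mv_Gamma M) mcn_omega"
    using unital_l_group_mcn_group mv_isomorphic_Gamma_mcn_group by blast
next
  fix M :: "'a ulgroup"
  assume M: "unital_l_group M \<and> mv_isomorphic (mv_Gamma M) mcn_omega"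
  then interpret unital_l_group M by simp
  let ?A = "carrier (mv_Gamma M)"
  obtain h where h: "h \<in> mv_hom (mv_Gamma M) mcn_omega" "bij_betw h ?A (carrier mcn_omega)"
    using M by (auto simp: mv_isomorphic_def)
  let ?k = "inv_into ?A h"
  have "mv_zero (mv_Gamma M) \<in> ?A"
    using one_in_Gamma by (simp add: mv_Gamma_def)
  then have k: "?k \<in> mv_hom mcn_omega (mv_Gamma M)"
    using mv_hom_inv_into[OF h] mv_plus_closed mv_neg_closed by blast
  have bij_k: "bij_betw ?k (carrier mcn_omega) ?A"
    using h(2) by (rule bij_betw_inv_into)
  \<comment> \<open>The unit interval of \<open>M\<close> is known only up to isomorphism, so the
    shift is conjugated by \<open>h\<close>.\<close>
  let ?f = "\<lambda>x. ?k (shift (h x))"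
  show "\<not> hopfian M"
  proof (rule not_hopfian_if_Gamma_endo[where f = ?f])
    show "?f \<in> mv_hom (mv_Gamma M) (mv_Gamma M)"
      by (intro mv_hom_comp[OF _ k] mv_hom_comp[OF h(1)] shift_mv_hom)
    have "?f ` ?A = ?k ` shift ` h ` ?A" by (simp add: image_image)
    then show "?f ` ?A = ?A"
      using h(2) bij_k shift_surj by (simp add: bij_betw_def)
    show "\<not> inj_on ?f ?A"
    proof
      assume "inj_on ?f ?A"
      \<comment> \<open>Injectivity of the composite makes \<open>?k\<close> after
        \<open>shift\<close> injective on the image of \<open>h\<close>, which is all of
        \<open>carrier mcn_omega\<close>, and hence \<open>shift\<close> itself injective
        there.\<close>
      then have "inj_on (?k \<circ> shift \<circ> h) ?A" by (simp add: comp_def)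
      then have "inj_on (?k \<circ> shift) (h ` ?A)" by (rule inj_on_imageI)
      then have "inj_on shift (carrier mcn_omega)"
        using h(2) by (auto simp: bij_betw_def dest: inj_on_imageI2)
      then show False using shift_not_inj by blast
    qed
  qed (use M in auto)
qed

end
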